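(* Let $\Phi$ be an irreducible root system, $\gamma=\gamma(\Phi)$, and $\mathbb F=\mathbb C(q^{1/\gamma})$. Then any maximal root subsystem $\Psi$ of $\Phi$ is of the form $\Phi_\Lambda$ for some $\Lambda\in\mathrm T_{\mathbb F}$. In particular, if $\Psi^\vee$ is closed in $\Phi^\vee$, then $\Psi=\Phi_\lambda$ for some $\lambda\in\frac1\gamma P$.
   Context: $\Phi$ is the root system of a complex simple Lie algebra $\mathfrak g$ with simple roots $\alpha_1,\dots,\alpha_n$, Weyl group $W$, root lattice $Q$, weight lattice $P$; $(\cdot,\cdot)$ is the $W$-invariant form with $(\alpha_i,\alpha_j)=d_ia_{ij}$ (symmetrized Cartan matrix, $d_i$ relatively prime positive integers, so short roots have squared length $2$), $\alpha^\vee=2\alpha/(\alpha,\alpha)$, $\Phi^\vee=\{\alpha^\vee\mid\alpha\in\Phi\}$, and for $\Psi\subset\Phi$, $\Psi^\vee=\{\alpha^\vee\mid\alpha\in\Psi\}$. A subset $\Psi\subset\Phi$ is a root subsystem if $-\alpha\in\Psi$ and $s_\beta\alpha\in\Psi$ for all $\alpha,\beta\in\Psi$. It is closed if $\alpha+\beta\in\Psi$ whenever $\alpha,\beta\in\Psi$ and $\alpha+\beta\in\Phi$. A proper root subsystem $\Psi\subsetneq\Phi$ is maximal if there is no root subsystem $\Psi'$ with $\Psi\subsetneq\Psi'\subsetneq\Phi$. Write the highest root as $\theta=\sum_ih_i\alpha_i$; $\gamma(\Phi)$ is the least common multiple of all those coefficients $h_i$ that are prime numbers. $q$ is an indeterminate.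 For a field $\mathbb F$ containing $\mathbb Q(q)$ inside an algebraic closure $\mathbf k$ of $\mathbb C(q)$, $\mathrm T_{\mathbb F}$ is the set of $\mathbb F$-algebra homomorphisms $\Lambda:U^0_{\mathbb F}\to\mathbb F$, where $U^0_{\mathbb F}$ is the group algebra over $\mathbb F$ of $Q$ with basis $K_\mu$ ($\mu\in Q$), i.e. the Cartan part of the quantum group of $\mathfrak g$. For $\Lambda\in\mathrm T_{\mathbb F}$, $\Phi_\Lambda=\{\alpha\in\Phi\mid\Lambda(K_{2\alpha})\in q^{\mathbb Z(\alpha,\alpha)}\}$. For $\lambda\in\mathfrak h^*$, $\Phi_\lambda=\{\alpha\in\Phi\mid(\lambda,\alpha^\vee)\in\mathbb Z\}$.
   Formalization: The claim λ ∈ (1/γ)P is asserted only when γ ≠ 1; for γ = 1 (type A) it fails, since Φ_λ = Φ for every λ ∈ P (e.g. Ψ = {±α} in A_2), and there only Ψ = Φ_λ for some λ is asserted. *)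

theory Defs
  imports
    "HOL-Analysis.Analysis"
    "HOL-Computational_Algebra.Computational_Algebra"
    "HOL-Library.Poly_Mapping"
    "HOL-Algebra.Algebraic_Closure_Type"
begin

section \<open>Root systems\<close>

text \<open>
  Roots live in the real form of the dual Cartan subalgebra spanned by the roots. The
  form $(\cdot,\cdot)$ is the ambient inner product; its normalization is imposed
  separately, relative to a base, by \<open>normalized_form\<close>.
\<close>

definition coroot :: "'a::euclidean_space \<Rightarrow> 'a" where
  "coroot \<alpha> = (2 / (\<alpha> \<bullet> \<alpha>)) *\<^sub>R \<alpha>"

definition root_reflection :: "'a::euclidean_space \<Rightarrow> 'a \<Rightarrow> 'a" where
  "root_reflection \<beta> x = x - (x \<bullet> coroot \<beta>) *\<^sub>R \<beta>"

definition root_system :: "'a::euclidean_space set \<Rightarrow> bool" where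
  "root_system \<Phi> \<longleftrightarrow>
     finite \<Phi> \<and> 0 \<notin> \<Phi> \<and> span \<Phi> = UNIV \<and>
     (\<forall>\<alpha>\<in>\<Phi>. \<forall>\<beta>\<in>\<Phi>. root_reflection \<beta> \<alpha> \<in> \<Phi>) \<and>
     (\<forall>\<alpha>\<in>\<Phi>. \<forall>\<beta>\<in>\<Phi>. \<alpha> \<bullet> coroot \<beta> \<in> \<int>) \<and>
     (\<forall>\<alpha>\<in>\<Phi>. \<forall>c. c *\<^sub>R \<alpha> \<in> \<Phi> \<longrightarrow> c = 1 \<or> c = - 1)"

definition irreducible_root_system :: "'a::euclidean_space set \<Rightarrow> bool" where
  "irreducible_root_system \<Phi> \<longleftrightarrow>
     root_system \<Phi> \<and> \<Phi> \<noteq> {} \<and>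
     \<not> (\<exists>A B. A \<noteq> {} \<and> B \<noteq> {} \<and> A \<union> B = \<Phi> \<and> A \<inter> B = {} \<and> (\<forall>\<alpha>\<in>A. \<forall>\<beta>\<in>B. \<alpha> \<bullet> \<beta> = 0))"

text \<open>The set \<open>\<Delta>\<close> of simple roots $\alpha_1,\dots,\alpha_n$.\<close>

definition root_base :: "'a::euclidean_space set \<Rightarrow> 'a set \<Rightarrow> bool" where
  "root_base \<Phi> \<Delta> \<longleftrightarrow>
     \<Delta> \<subseteq> \<Phi> \<and> independent \<Delta> \<and>
     (\<forall>\<beta>\<in>\<Phi>. \<exists>c :: 'a \<Rightarrow> nat.
        \<beta> = (\<Sum>\<alpha>\<in>\<Delta>. real (c \<alpha>) *\<^sub>R \<alpha>) \<or> \<beta> = - (\<Sum>\<alpha>\<in>\<Delta>. real (c \<alpha>) *\<^sub>R \<alpha>))"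

text \<open>
  The condition $(\alpha_i,\alpha_j) = d_i a_{ij}$ with relatively prime positive integers
  $d_i$, where $a_{ij} = (\alpha_i^\vee,\alpha_j)$ is the Cartan matrix.
\<close>

definition normalized_form :: "'a::euclidean_space set \<Rightarrow> bool" where
  "normalized_form \<Delta> \<longleftrightarrow>
     (\<exists>d :: 'a \<Rightarrow> nat. (\<forall>\<alpha>\<in>\<Delta>. d \<alpha> > 0) \<and> Gcd (d ` \<Delta>) = 1 \<and>
        (\<forall>\<alpha>\<in>\<Delta>. \<forall>\<beta>\<in>\<Delta>. \<alpha> \<bullet> \<beta> = real (d \<alpha>) * (coroot \<alpha> \<bullet> \<beta>)))"

definition root_subsystem :: "'a::euclidean_space set \<Rightarrow> 'a set \<Rightarrow> bool" where
  "root_subsystem \<Phi> \<Psi> \<longleftrightarrow>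
     \<Psi> \<subseteq> \<Phi> \<and> (\<forall>\<alpha>\<in>\<Psi>. - \<alpha> \<in> \<Psi>) \<and> (\<forall>\<alpha>\<in>\<Psi>. \<forall>\<beta>\<in>\<Psi>. root_reflection \<beta> \<alpha> \<in> \<Psi>)"

definition closed_in_roots :: "'a::euclidean_space set \<Rightarrow> 'a set \<Rightarrow> bool" where
  "closed_in_roots \<Phi> \<Psi> \<longleftrightarrow> (\<forall>\<alpha>\<in>\<Psi>. \<forall>\<beta>\<in>\<Psi>. \<alpha> + \<beta> \<in> \<Phi> \<longrightarrow> \<alpha> + \<beta> \<in> \<Psi>)"

definition maximal_root_subsystem :: "'a::euclidean_space set \<Rightarrow> 'a set \<Rightarrow> bool" where
  "maximal_root_subsystem \<Phi> \<Psi> \<longleftrightarrow>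
     root_subsystem \<Phi> \<Psi> \<and> \<Psi> \<subset> \<Phi> \<and> \<not> (\<exists>\<Psi>'. root_subsystem \<Phi> \<Psi>' \<and> \<Psi> \<subset> \<Psi>' \<and> \<Psi>' \<subset> \<Phi>)"

definition highest_root :: "'a::euclidean_space set \<Rightarrow> 'a set \<Rightarrow> 'a" where
  "highest_root \<Phi> \<Delta> =
     (THE \<theta>. \<theta> \<in> \<Phi> \<and> (\<forall>\<beta>\<in>\<Phi>. \<forall>\<alpha>\<in>\<Delta>. representation \<Delta> \<beta> \<alpha> \<le> representation \<Delta> \<theta> \<alpha>))"

text \<open>
  If no coefficient is prime (which happens exactly in type $A$), the least common multiple
  is the empty one, so $\gamma = 1$. Then every \<open>\<mu>\<close> in $\frac1\gamma P = P$ satisfies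
  \<open>integral_roots \<Phi> \<mu> = \<Phi>\<close>, so no proper subsystem can be written as \<open>integral_roots \<Phi> \<mu>\<close>
  with such a \<open>\<mu>\<close>. The theorem therefore asserts that \<open>\<mu>\<close> lies in $\frac1\gamma P$ only when
  $\gamma \neq 1$.
\<close>

definition root_gamma :: "'a::euclidean_space set \<Rightarrow> 'a set \<Rightarrow> nat" where
  "root_gamma \<Phi> \<Delta> =
     Lcm {h :: nat. Factorial_Ring.prime h \<and> (\<exists>\<alpha>\<in>\<Delta>. representation \<Delta> (highest_root \<Phi> \<Delta>) \<alpha> = real h)}"

definition root_lattice :: "'a::euclidean_space set \<Rightarrow> 'a set" where
  "root_lattice \<Phi> = {\<Sum>\<alpha>\<in>\<Phi>. real_of_int (c \<alpha>) *\<^sub>R \<alpha> | c. True}"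

definition weight_lattice :: "'a::euclidean_space set \<Rightarrow> 'a set" where
  "weight_lattice \<Phi> = {\<mu>. \<forall>\<alpha>\<in>\<Phi>. \<mu> \<bullet> coroot \<alpha> \<in> \<int>}"

definition integral_roots :: "'a::euclidean_space set \<Rightarrow> 'a \<Rightarrow> 'a set" where
  "integral_roots \<Phi> \<mu> = {\<alpha>\<in>\<Phi>. \<mu> \<bullet> coroot \<alpha> \<in> \<int>}"


section \<open>The algebraic closure of $\mathbb C(q)$ and its subfields\<close>

type_synonym qclosure = "complex poly fract alg_closure"

definition qconst :: "complex \<Rightarrow> qclosure" where
  "qconst c = to_ac (Fract [:c:] 1)"

definition qvar :: qclosure where
  "qvar = to_ac (Fract [:0, 1:] 1)"

definition is_subfield :: "'k::field set \<Rightarrow> bool" where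
  "is_subfield K \<longleftrightarrow>
     0 \<in> K \<and> 1 \<in> K \<and> (\<forall>x\<in>K. \<forall>y\<in>K. x + y \<in> K \<and> x * y \<in> K) \<and>
     (\<forall>x\<in>K. - x \<in> K \<and> inverse x \<in> K)"

text \<open>The field $\mathbb C(t)$, for $t$ in the algebraic closure.\<close>

definition complex_adjoin :: "qclosure \<Rightarrow> qclosure set" where
  "complex_adjoin t = is_subfield hull (insert t (range qconst))"


section \<open>The Cartan part of the quantum group and its characters\<close>

text \<open>
  The group algebra of the root lattice over \<open>F\<close>, as a subring of the group algebra (with
  convolution product) of the whole ambient vector space over the algebraic closure.
\<close>

definition cartan_algebra ::
    "'a::euclidean_space set \<Rightarrow> qclosure set \<Rightarrow> ('a \<Rightarrow>\<^sub>0 qclosure) set" where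
  "cartan_algebra \<Phi> F =
     {x. Poly_Mapping.keys x \<subseteq> root_lattice \<Phi> \<and> (\<forall>\<mu>. Poly_Mapping.lookup x \<mu> \<in> F)}"

definition Kelt :: "'a::euclidean_space \<Rightarrow> ('a \<Rightarrow>\<^sub>0 qclosure)" where
  "Kelt \<mu> = Poly_Mapping.single \<mu> 1"

text \<open>
  The \<open>F\<close>-algebra homomorphisms from the Cartan part to \<open>F\<close>; values outside the algebra are
  irrelevant. The scalar \<open>c\<close> is embedded as \<open>c\<close> times the unit $K_0$.
\<close>

definition torus_characters ::
    "'a::euclidean_space set \<Rightarrow> qclosure set \<Rightarrow> (('a \<Rightarrow>\<^sub>0 qclosure) \<Rightarrow> qclosure) set" where
  "torus_characters \<Phi> F =
     {\<Lambda>. \<Lambda> \<in> cartan_algebra \<Phi> F \<rightarrow> F \<and> \<Lambda> 1 = 1 \<and>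
        (\<forall>x\<in>cartan_algebra \<Phi> F. \<forall>y\<in>cartan_algebra \<Phi> F.
           \<Lambda> (x + y) = \<Lambda> x + \<Lambda> y \<and> \<Lambda> (x * y) = \<Lambda> x * \<Lambda> y) \<and>
        (\<forall>c\<in>F. \<forall>x\<in>cartan_algebra \<Phi> F. \<Lambda> (Poly_Mapping.single 0 c * x) = c * \<Lambda> x)}"

text \<open>
  With the normalized form, $(\alpha,\alpha)$ is an integer; the integer exponent \<open>k\<close> below
  ranges over $\mathbb Z(\alpha,\alpha)$.
\<close>

definition quantum_integral_roots ::
    "'a::euclidean_space set \<Rightarrow> (('a \<Rightarrow>\<^sub>0 qclosure) \<Rightarrow> qclosure) \<Rightarrow> 'a set" where
  "quantum_integral_roots \<Phi> \<Lambda> =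
     {\<alpha>\<in>\<Phi>. \<Lambda> (Kelt (2 *\<^sub>R \<alpha>)) \<in>
        {qvar powi k | k m :: int. real_of_int k = real_of_int m * (\<alpha> \<bullet> \<alpha>)}}"

end

theory Submission
  imports Defs "HOL-Library.Real_Mod"
begin

text \<open>
  If $\Psi$ does not generate $Q$, some $v$ pairs integrally with $\Psi$ but not with $Q$, and the
  character $K_\mu \mapsto e^{i\pi(v,\mu)}$ works by maximality. Otherwise $\Psi$ contains all short
  roots: in an expression $\alpha = \sum_i \beta_i$ of a short root by elements of $\Psi$,
  some $\beta_i$ satisfies $s_{\beta_i}\alpha = \alpha - \beta_i$. By the dual argument $\Psi^\vee$
  then cannot generate $Q^\vee$, for else $\Psi$ would contain the long roots too.
  So for some prime $p$ there is $v \in \frac1p P$ that pairs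
  integrally with $\Psi^\vee$ but not with $Q^\vee$, and one uses the character
  $K_\mu \mapsto q^{(v,\mu)}$.

  It remains to see that $p$ divides $\gamma$. If $\Psi$ has smaller rank, $p$ is arbitrary.
  If $\Psi$ has full rank and $p$ is not a ratio of squared root lengths, a multiple of $v$ is
  integral on exactly those roots on whose coroots $v$ is, and the argument of Borel and de Siebenthal shows that
  $p$ is a coefficient of the highest root. If $p$ is such a ratio, apply that argument to
  the subsystem of long roots instead.
\<close>

text \<open>Neither lattice suffices alone: the short roots of G2 form a maximal \<Psi> that
  generates Q, so only coroots separate it from \<Phi>. Maximality reduces each case to finding one
  vector \<open>v\<close>: the roots on which, or on whose coroots, \<open>v\<close> is integral
  form a subsystem, and if this contains \<Psi> and is not \<Phi>, it is \<Psi>. The torsion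
  character takes values in the complex numbers, so its order is irrelevant. Only the character
  built from q needs a root of q, and its exponents must have denominators dividing \<gamma>. The
  identity (v,\<alpha>) = (v,\<alpha>^vee)(\<alpha>,\<alpha>)/2 together with the evenness of
  (\<alpha>,\<alpha>) carries the bound from coroots to roots; this is where the normalization of
  the form enters. Sublattices are studied at one prime at a time: either a vector of order p
  detects the sublattice, or its index is prime to p. A prescribed p is needed twice: when the rank
  drops, p is picked to divide \<gamma> if possible, and for the lattice of long roots p is the
  ratio of squared lengths.\<close>

section \<open>Additive spans and characters of lattices\<close>

text \<open>Sums without subtraction: for a set closed under negation this is already the generated
  subgroup, and the number of summands is available for induction.\<close>

definition sums_of :: "'a::comm_monoid_add set \<Rightarrow> 'a set" where
  "sums_of S = {sum_list xs | xs. set xs \<subseteq> S}"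

lemma sums_of_zero: "0 \<in> sums_of S"
  unfolding sums_of_def by (auto intro: exI[of _ "[]"])

lemma sums_of_base: "x \<in> S \<Longrightarrow> x \<in> sums_of S"
  unfolding sums_of_def by (auto intro: exI[of _ "[x]"])

lemma sums_of_add:
  assumes "x \<in> sums_of S" "y \<in> sums_of S"
  shows "x + y \<in> sums_of S"
proof -
  obtain xs ys where "x = sum_list xs" "set xs \<subseteq> S" "y = sum_list ys" "set ys \<subseteq> S"
    using assms unfolding sums_of_def by auto
  then show ?thesis
    unfolding sums_of_def by (auto intro!: exI[of _ "xs @ ys"])
qed

lemma sums_of_induct [consumes 1, case_names zero add]:
  assumes "x \<in> sums_of S" and "P 0"
    and "\<And>a y. a \<in> S \<Longrightarrow> y \<in> sums_of S \<Longrightarrow> P y \<Longrightarrow> P (a + y)"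
  shows "P x"
proof -
  obtain xs where "x = sum_list xs" "set xs \<subseteq> S"
    using assms(1) unfolding sums_of_def by auto
  moreover have "set xs \<subseteq> S \<Longrightarrow> P (sum_list xs)" for xs
  proof (induction xs)
    case (Cons a xs)
    then show ?case using assms(3)[of a "sum_list xs"] by (auto simp: sums_of_def)
  qed (use assms(2) in simp)
  ultimately show ?thesis by simp
qed

lemma sums_of_sum: "(\<And>i. i \<in> I \<Longrightarrow> f i \<in> sums_of S) \<Longrightarrow> sum f I \<in> sums_of S"
  by (induction I rule: infinite_finite_induct) (auto simp: sums_of_zero intro: sums_of_add)

lemma sums_of_uminus:
  fixes x :: "'a::ab_group_add"
  assumes "x \<in> sums_of S" and "\<And>a. a \<in> S \<Longrightarrow> - a \<in> S"
  shows "- x \<in> sums_of S"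
  using assms(1)
proof (induction rule: sums_of_induct)
  case (add a y)
  then show ?case
    using sums_of_add[OF sums_of_base[OF assms(2)[OF add.hyps(1)]] add.IH] by simp
qed (simp add: sums_of_zero)

lemma sums_of_scaleR_int:
  fixes x :: "'a::real_vector"
  assumes x: "x \<in> sums_of S" and neg: "\<And>a. a \<in> S \<Longrightarrow> - a \<in> S"
  shows "of_int n *\<^sub>R x \<in> sums_of S"
proof -
  have nat: "of_nat k *\<^sub>R x \<in> sums_of S" for k
    by (induction k) (auto simp: sums_of_zero algebra_simps intro: sums_of_add x)
  show ?thesis
  proof (cases "n \<ge> 0")
    case True
    then show ?thesis using nat[of "nat n"] by simp
  next
    case False
    then show ?thesis using sums_of_uminus[OF nat[of "nat (- n)"] neg] by simp
  qed
qed

lemma sums_of_subset_span: "sums_of S \<subseteq> span (S :: 'a::real_vector set)"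
proof
  fix x assume "x \<in> sums_of S"
  then show "x \<in> span S"
    by (induction rule: sums_of_induct) (auto simp: span_zero intro: span_add span_base)
qed

text \<open>Linear algebra over the integers localized at \<open>p\<close>: a subgroup that no
  nonzero functional modulo \<open>p\<close> annihilates becomes everything after localization.
  Elimination of one coordinate at a time proves it, with a pivot in \<open>H\<close> whose new
  coordinate is a unit modulo \<open>p\<close>.\<close>

lemma subgroup_int_functions_mod_prime:
  fixes B :: "'b set" and H :: "('b \<Rightarrow> int) set" and p :: int
  assumes "finite B" and "Factorial_Ring.prime p"
    and "H \<noteq> {}"
    and "\<And>x y. x \<in> H \<Longrightarrow> y \<in> H \<Longrightarrow> (\<lambda>b. x b - y b) \<in> H"
  shows "(\<exists>f. (\<exists>b\<in>B. \<not> p dvd f b) \<and> (\<forall>x\<in>H. p dvd (\<Sum>b\<in>B. f b * x b))) \<or>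
    (\<exists>N. coprime N p \<and> (\<forall>b\<in>B. \<exists>x\<in>H. \<forall>b'\<in>B. x b' = (if b' = b then N else 0)))"
  using assms(1,3,4)
proof (induction B arbitrary: H rule: finite_induct)
  case empty
  then show ?case by (auto intro: exI[of _ 1])
next
  case (insert a B)
  note diff = insert.prems(2)
  have zero: "(\<lambda>_. 0) \<in> H"
    using insert.prems(1) diff by fastforce
  have neg: "(\<lambda>b. - x b) \<in> H" if "x \<in> H" for x
    using diff[OF zero that] by simp
  have add: "(\<lambda>b. x b + y b) \<in> H" if "x \<in> H" "y \<in> H" for x y
    using diff[OF that(1) neg[OF that(2)]] by simp
  have nat_scale: "(\<lambda>b. int n * x b) \<in> H" if "x \<in> H" for n x
    by (induction n) (use zero add[OF that] in \<open>auto simp: ring_distribs\<close>)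
  have scale: "(\<lambda>b. c * x b) \<in> H" if "x \<in> H" for c x
  proof (cases "c \<ge> 0")
    case True
    then show ?thesis using nat_scale[OF that, of "nat c"] by simp
  next
    case False
    then show ?thesis using neg[OF nat_scale[OF that, of "nat (- c)"]] by simp
  qed
  have sum: "(\<lambda>b. \<Sum>i\<in>I. g i b) \<in> H" if "finite I" "\<And>i. i \<in> I \<Longrightarrow> g i \<in> H" for I :: "'b set" and g
    using that by (induction I rule: finite_induct) (auto simp: zero add)
  show ?case
  proof (cases "\<forall>x\<in>H. p dvd x a")
    case True
    have "(\<Sum>b\<in>insert a B. (if b = a then 1 else 0) * x b) = x a" for x :: "'b \<Rightarrow> int"
      using insert.hyps by (simp add: if_distrib[of "\<lambda>c. c * _"] sum.delta cong: if_cong)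
    with True show ?thesis
      using \<open>Factorial_Ring.prime p\<close> not_prime_unit[of p]
      by (intro disjI1 exI[of _ "\<lambda>b. if b = a then 1 else 0"]) auto
  next
    case False
    then obtain v where v: "v \<in> H" "\<not> p dvd v a" by blast
    let ?H' = "{x \<in> H. x a = 0}"
    have "?H' \<noteq> {}" using zero by auto
    moreover have "(\<lambda>b. x b - y b) \<in> ?H'" if "x \<in> ?H'" "y \<in> ?H'" for x y
      using that diff by auto
    ultimately consider
      f where "\<exists>b\<in>B. \<not> p dvd f b" "\<forall>x\<in>?H'. p dvd (\<Sum>b\<in>B. f b * x b)"
      | N where "coprime N p" "\<forall>b\<in>B. \<exists>x\<in>?H'. \<forall>b'\<in>B. x b' = (if b' = b then N else 0)"
      using insert.IH[of ?H'] by blast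
    then show ?thesis
    proof cases
      case 1
      have "coprime (v a) p"
        using v(2) \<open>Factorial_Ring.prime p\<close> by (metis coprime_commute prime_imp_coprime)
      then obtain u w where u: "u * v a + w * p = 1"
        using bezout_int[of "v a" p] by auto
      \<comment> \<open>Since \<open>u\<close> inverts \<open>v a\<close> modulo \<open>p\<close>,
        this coefficient at \<open>a\<close> makes the extended functional vanish on the pivot
        \<open>v\<close>.\<close>
      define f' where "f' = (\<lambda>b. if b = a then - u * (\<Sum>b\<in>B. f b * v b) else f b)"
      have sum_f': "(\<Sum>b\<in>insert a B. f' b * x b) = f' a * x a + (\<Sum>b\<in>B. f b * x b)" for x
      proof -
        have "(\<Sum>b\<in>B. f' b * x b) = (\<Sum>b\<in>B. f b * x b)"
          using insert.hyps by (intro sum.cong) (auto simp: f'_def)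
        then show ?thesis using insert.hyps by simp
      qed
      have "p dvd (\<Sum>b\<in>insert a B. f' b * x b)" if "x \<in> H" for x
      proof -
        let ?S = "\<lambda>x. \<Sum>b\<in>B. f b * x b"
        \<comment> \<open>Eliminating the coordinate \<open>a\<close> from \<open>x\<close> costs a
          factor \<open>v a\<close>, which is cancelled at the end because \<open>p\<close> does not
          divide it.\<close>
        have "(\<lambda>b. v a * x b - x a * v b) \<in> ?H'"
          using diff[OF scale[OF that] scale[OF v(1)]] by simp
        then have "p dvd ?S (\<lambda>b. v a * x b - x a * v b)"
          using 1(2) by auto
        also have "?S (\<lambda>b. v a * x b - x a * v b) = v a * ?S x - x a * ?S v"
          by (simp add: sum_subtractf sum_distrib_left algebra_simps)
        finally have "p dvd v a * ?S x - x a * ?S v" .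
        moreover have "v a * u - 1 = p * - w"
          using u by (simp add: algebra_simps)
        then have "p dvd x a * ?S v * (v a * u - 1)"
          by simp
        ultimately have "p dvd (v a * ?S x - x a * ?S v) - x a * ?S v * (v a * u - 1)"
          by (rule dvd_diff)
        also have "\<dots> = v a * (f' a * x a + ?S x)"
          by (simp add: f'_def algebra_simps)
        finally have "p dvd f' a * x a + ?S x"
          using v(2) \<open>Factorial_Ring.prime p\<close> prime_dvd_mult_iff by blast
        then show ?thesis by (simp only: sum_f')
      qed
      moreover have "\<exists>b\<in>insert a B. \<not> p dvd f' b"
        using 1(1) insert.hyps by (auto simp: f'_def)
      ultimately show ?thesis by blast
    next
      case 2
      obtain e where e: "\<And>b. b \<in> B \<Longrightarrow> e b \<in> H \<and> e b a = 0 \<and>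
          (\<forall>b'\<in>B. e b b' = (if b' = b then N else 0))"
        using 2(2) by (simp add: Bex_def) metis
      \<comment> \<open>The coordinates of \<open>N * v\<close> in \<open>B\<close> are cleared by
        the vectors \<open>e i\<close>; what remains is \<open>N * v a\<close> at \<open>a\<close>,
        which becomes the new common multiplier.\<close>
      let ?y = "\<lambda>b. N * v b - (\<Sum>i\<in>B. v i * e i b)"
      have "?y \<in> H"
        using e insert.hyps by (intro diff scale v sum) auto
      moreover have "?y b' = (if b' = a then N * v a else 0)" if "b' \<in> insert a B" for b'
      proof (cases "b' = a")
        case True
        then show ?thesis using e by simp
      next
        case False
        with that have "b' \<in> B" by simp
        then have "(\<Sum>i\<in>B. v i * e i b') = (\<Sum>i\<in>B. if i = b' then v i * N else 0)"
          using e by (intro sum.cong) auto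
        then show ?thesis using \<open>b' \<in> B\<close> insert.hyps False by simp
      qed
      ultimately have "\<exists>x\<in>H. \<forall>b'\<in>insert a B. x b' = (if b' = a then N * v a else 0)"
        by (intro bexI[of _ ?y]) auto
      moreover have "\<exists>x\<in>H. \<forall>b'\<in>insert a B. x b' = (if b' = b then N * v a else 0)" if "b \<in> B" for b
        using e[OF that] insert.hyps that
        by (intro bexI[of _ "\<lambda>b'. v a * e b b'"]) (auto simp: scale)
      moreover have "coprime (N * v a) p"
        using 2(1) v(2) \<open>Factorial_Ring.prime p\<close>
        by (metis coprime_commute coprime_mult_left_iff prime_imp_coprime)
      ultimately show ?thesis by blast
    qed
  qed
qed

lemma ex_vector_with_inner_on_independent:
  fixes B :: "'a::euclidean_space set"
  assumes "independent B"
  shows "\<exists>v. \<forall>b\<in>B. v \<bullet> b = g b"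
proof -
  obtain h :: "'a \<Rightarrow> real" where h: "linear h" "\<forall>b\<in>B. h b = g b"
    using linear_independent_extend[OF assms] by blast
  have "(\<Sum>i\<in>Basis. h i *\<^sub>R i) \<bullet> x = h x" for x
  proof -
    have "h x = h (\<Sum>i\<in>Basis. (x \<bullet> i) *\<^sub>R i)"
      by (simp add: euclidean_representation)
    also have "\<dots> = (\<Sum>i\<in>Basis. (x \<bullet> i) * h i)"
      by (simp add: linear_sum[OF h(1)] linear_scale[OF h(1)])
    finally show ?thesis
      by (simp add: inner_sum_left inner_commute[of x] mult.commute)
  qed
  with h(2) show ?thesis by metis
qed

lemma representation_expand:
  assumes "independent B" "finite B" "span B = UNIV"
  shows "x = (\<Sum>b\<in>B. representation B x b *\<^sub>R b)"
  using sum_representation_eq[OF assms(1), of x B] assms by simp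

lemma inner_Ints_if_inner_basis_Ints:
  assumes "independent B" "finite B" "span B = UNIV"
    and "\<And>b. b \<in> B \<Longrightarrow> representation B x b \<in> \<int>" "\<And>b. b \<in> B \<Longrightarrow> v \<bullet> b \<in> \<int>"
  shows "v \<bullet> x \<in> \<int>"
proof -
  have "v \<bullet> x = (\<Sum>b\<in>B. representation B x b * (v \<bullet> b))"
    using arg_cong[OF representation_expand[OF assms(1-3), of x], of "inner v"]
    by (simp add: inner_sum_right)
  then show ?thesis using assms(4,5) by (auto intro!: Ints_sum Ints_mult)
qed

text \<open>A functional modulo \<open>p\<close>, divided by \<open>p\<close>, becomes a vector that
  is integral on the sublattice but not on the lattice. In the other alternative the index is finite
  and prime to \<open>p\<close>.\<close>

lemma lattice_mod_prime:
  fixes B S :: "'a::euclidean_space set" and p :: int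
  assumes B: "independent B" "finite B" "span B = UNIV" and p: "Factorial_Ring.prime p"
    and S: "\<And>x b. x \<in> S \<Longrightarrow> representation B x b \<in> \<int>"
    and neg: "\<And>x. x \<in> S \<Longrightarrow> - x \<in> S"
  shows "(\<exists>v. (\<forall>b\<in>B. of_int p * (v \<bullet> b) \<in> \<int>) \<and> (\<exists>b\<in>B. v \<bullet> b \<notin> \<int>) \<and> (\<forall>x\<in>S. v \<bullet> x \<in> \<int>)) \<or>
    (\<exists>N. coprime N p \<and> (\<forall>b\<in>B. of_int N *\<^sub>R b \<in> sums_of S))"
proof -
  define H where "H = {c :: 'a \<Rightarrow> int. (\<Sum>b\<in>B. of_int (c b) *\<^sub>R b) \<in> sums_of S}"
  have "(\<lambda>_. 0) \<in> H" by (simp add: H_def sums_of_zero)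
  then have "H \<noteq> {}" by blast
  moreover have "(\<lambda>b. x b - y b) \<in> H" if "x \<in> H" "y \<in> H" for x y
    using that sums_of_add[OF _ sums_of_uminus[OF _ neg], of "\<Sum>b\<in>B. of_int (x b) *\<^sub>R b" "\<Sum>b\<in>B. of_int (y b) *\<^sub>R b"]
    by (auto simp: H_def algebra_simps sum_subtractf)
  ultimately consider
      f where "\<exists>b\<in>B. \<not> p dvd f b" "\<forall>x\<in>H. p dvd (\<Sum>b\<in>B. f b * x b)"
      | N where "coprime N p" "\<forall>b\<in>B. \<exists>x\<in>H. \<forall>b'\<in>B. x b' = (if b' = b then N else 0)"
    using subgroup_int_functions_mod_prime[OF B(2) p, of H] by blast
  then show ?thesis
  proof cases
    case 1
    obtain v where v: "\<And>b. b \<in> B \<Longrightarrow> v \<bullet> b = of_int (f b) / of_int p"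
      using ex_vector_with_inner_on_independent[OF B(1), of "\<lambda>b. of_int (f b) / of_int p"] by blast
    have p0: "p \<noteq> 0" using p by auto
    have "of_int p * (v \<bullet> b) \<in> \<int>" if "b \<in> B" for b
      using v[OF that] p0 by simp
    moreover have "\<exists>b\<in>B. v \<bullet> b \<notin> \<int>"
    proof -
      obtain b where b: "b \<in> B" "\<not> p dvd f b" using 1(1) by blast
      have "v \<bullet> b \<notin> \<int>"
      proof
        assume "v \<bullet> b \<in> \<int>"
        then obtain m where "v \<bullet> b = of_int m" by (elim Ints_cases)
        then have "real_of_int (f b) = of_int (p * m)"
          using v[OF b(1)] p0 by (simp add: field_simps)
        then have "f b = p * m" by (simp only: of_int_eq_iff)
        with b(2) show False by simp
      qed
      with b show ?thesis by blast
    qed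
    moreover have "v \<bullet> x \<in> \<int>" if "x \<in> S" for x
    proof -
      define c where "c = (\<lambda>b. \<lfloor>representation B x b\<rfloor>)"
      have c: "of_int (c b) = representation B x b" for b
        using S[OF that] by (auto simp: c_def elim!: Ints_cases)
      have xc: "x = (\<Sum>b\<in>B. of_int (c b) *\<^sub>R b)"
        unfolding c by (rule representation_expand[OF B])
      then have "c \<in> H" using that by (simp add: H_def sums_of_base)
      then obtain m where m: "(\<Sum>b\<in>B. f b * c b) = p * m" using 1(2) by (meson dvdE)
      have "v \<bullet> x = (\<Sum>b\<in>B. of_int (c b) * (v \<bullet> b))"
        by (subst xc) (simp add: inner_sum_right)
      also have "\<dots> = (\<Sum>b\<in>B. of_int (f b * c b)) / of_int p"
        by (simp add: v sum_divide_distrib mult.commute)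
      also have "\<dots> = of_int m"
        using p0 unfolding of_int_sum[symmetric] m by simp
      finally show ?thesis by simp
    qed
    ultimately show ?thesis by blast
  next
    case 2
    have "of_int N *\<^sub>R b \<in> sums_of S" if b: "b \<in> B" for b
    proof -
      obtain x where x: "x \<in> H" "\<forall>b'\<in>B. x b' = (if b' = b then N else 0)"
        using 2(2) b by blast
      have "(\<Sum>b'\<in>B. of_int (x b') *\<^sub>R b') = (\<Sum>b'\<in>B. if b' = b then of_int N *\<^sub>R b else 0)"
        using x(2) by (intro sum.cong) auto
      then show ?thesis using x(1) b B(2) by (simp add: H_def)
    qed
    with 2(1) show ?thesis by blast
  qed
qed

lemma proper_sublattice_character:
  fixes B S :: "'a::euclidean_space set"
  assumes B: "independent B" "finite B" "span B = UNIV"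
    and S: "\<And>x b. x \<in> S \<Longrightarrow> representation B x b \<in> \<int>"
    and neg: "\<And>x. x \<in> S \<Longrightarrow> - x \<in> S"
    and proper: "\<not> B \<subseteq> sums_of S"
  obtains p :: int and v where "Factorial_Ring.prime p" "\<And>b. b \<in> B \<Longrightarrow> of_int p * (v \<bullet> b) \<in> \<int>"
    "\<exists>b\<in>B. v \<bullet> b \<notin> \<int>" "\<And>x. x \<in> S \<Longrightarrow> v \<bullet> x \<in> \<int>"
proof -
  define I where "I = {N :: int. \<forall>b\<in>B. of_int N *\<^sub>R b \<in> sums_of S}"
  have "\<exists>p::int. Factorial_Ring.prime p \<and> (\<forall>N\<in>I. \<not> coprime N p)"
  proof (rule ccontr)
    assume "\<not> ?thesis"
    then have *: "\<exists>N\<in>I. coprime N p" if "Factorial_Ring.prime p" for p :: int using that by blast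
    have diff: "M - N * q \<in> I" if "M \<in> I" "N \<in> I" for M N q
    proof -
      have "of_int (M - N * q) *\<^sub>R b \<in> sums_of S" if "b \<in> B" for b
        using sums_of_add[of "of_int M *\<^sub>R b" S "of_int (- q) *\<^sub>R (of_int N *\<^sub>R b)"]
          \<open>M \<in> I\<close> \<open>N \<in> I\<close> that sums_of_scaleR_int[OF _ neg, of "of_int N *\<^sub>R b" "- q"]
        by (auto simp: I_def algebra_simps)
      then show ?thesis by (simp add: I_def)
    qed
    \<comment> \<open>Any prime would do here: coprimality only supplies a nonzero
      multiplier.\<close>
    have "Factorial_Ring.prime (2::int)" by simp
    then obtain N0 where N0: "N0 \<in> I" "coprime N0 (2::int)" using * by blast
    then have "N0 \<noteq> 0" by auto
    \<comment> \<open>The factor is chosen so that the difference is \<open>N0 * sgn N0\<close>, the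
      absolute value.\<close>
    have "N0 - N0 * (1 - sgn N0) \<in> I" using diff[OF N0(1) N0(1)] .
    then have "\<bar>N0\<bar> \<in> I" by (simp add: algebra_simps abs_sgn)
    then have ex: "\<exists>n. n > 0 \<and> int n \<in> I"
      using \<open>N0 \<noteq> 0\<close> by (intro exI[of _ "nat \<bar>N0\<bar>"]) auto
    define d where "d = (LEAST n. n > 0 \<and> int n \<in> I)"
    have d: "d > 0" "int d \<in> I" using LeastI_ex[OF ex] unfolding d_def by auto
    have d_dvd: "int d dvd N" if "N \<in> I" for N
    proof (rule ccontr)
      assume "\<not> int d dvd N"
      then have pos: "N mod int d > 0"
        using d(1) by (metis dvd_eq_mod_eq_0 of_nat_0_less_iff order_le_less pos_mod_sign)
      have "N mod int d = N - int d * (N div int d)" by (simp add: minus_mult_div_eq_mod)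
      then have "N mod int d \<in> I" using diff[OF that d(2)] by simp
      then have "d \<le> nat (N mod int d)"
        unfolding d_def by (intro Least_le) (use pos in \<open>auto simp flip: d_def\<close>)
      moreover have "N mod int d < int d" using d(1) by simp
      ultimately show False using pos by linarith
    qed
    have "d = 1"
    proof (rule ccontr)
      assume "d \<noteq> 1"
      then obtain p where p: "Factorial_Ring.prime p" "p dvd d" using prime_factor_nat by blast
      then obtain N where "N \<in> I" "coprime N (int p)" using *[of "int p"] by auto
      moreover have "int p dvd N" using d_dvd[OF \<open>N \<in> I\<close>] p(2) by (meson dvd_trans int_dvd_int_iff)
      ultimately show False using p(1)
        by (metis coprime_absorb_right not_prime_unit prime_nat_int_transfer)
    qed
    with d(2) proper show False by (auto simp: I_def)
  qed
  then obtain p :: int where "Factorial_Ring.prime p" "\<forall>N\<in>I. \<not> coprime N p" by blast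
  with lattice_mod_prime[OF B \<open>Factorial_Ring.prime p\<close> S neg] that show ?thesis
    unfolding I_def by blast
qed

section \<open>Root systems\<close>

lemma inner_coroot: "x \<bullet> coroot \<beta> = 2 * (x \<bullet> \<beta>) / (\<beta> \<bullet> \<beta>)"
  by (simp add: coroot_def)

lemma coroot_coroot [simp]: "coroot (coroot \<alpha>) = \<alpha>"
  by (cases "\<alpha> = 0") (auto simp: coroot_def)

lemma inj_coroot: "inj coroot"
  by (metis coroot_coroot injI)

lemma coroot_uminus: "coroot (- \<alpha>) = - coroot \<alpha>"
  by (simp add: coroot_def)

lemma coroot_inner_self: "coroot \<alpha> \<bullet> coroot \<alpha> = 4 / (\<alpha> \<bullet> \<alpha>)"
  by (simp add: coroot_def)

lemma root_reflection_coroot: "root_reflection (coroot \<beta>) x = root_reflection \<beta> x"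
  by (simp add: root_reflection_def) (simp add: coroot_def)

lemma inner_root_reflection: "root_reflection \<beta> x \<bullet> y = x \<bullet> root_reflection \<beta> y"
  by (simp add: root_reflection_def inner_coroot algebra_simps inner_commute)

lemma root_reflection_involution [simp]: "root_reflection \<beta> (root_reflection \<beta> x) = x"
  by (cases "\<beta> = 0") (simp_all add: root_reflection_def inner_coroot algebra_simps)

lemma root_reflection_isometry: "root_reflection \<beta> x \<bullet> root_reflection \<beta> y = x \<bullet> y"
  by (simp add: inner_root_reflection)

lemma linear_root_reflection: "linear (root_reflection \<beta>)"
  by (rule linearI) (simp_all add: root_reflection_def algebra_simps)

lemma coroot_root_reflection: "coroot (root_reflection \<beta> \<alpha>) = root_reflection \<beta> (coroot \<alpha>)"
  unfolding coroot_def[of "root_reflection \<beta> \<alpha>"] coroot_def[of \<alpha>]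
  by (simp add: root_reflection_isometry linear_scale[OF linear_root_reflection])

lemma orthogonal_to_spanning_set:
  assumes "span A = UNIV" and "\<And>a. a \<in> A \<Longrightarrow> x \<bullet> a = (0::real)"
  shows "x = 0"
proof -
  have "x \<in> span A" using assms(1) by simp
  then have "x \<bullet> x = 0"
    using assms(2) by (metis orthogonal_commute orthogonal_def orthogonal_to_span)
  then show ?thesis by simp
qed

lemma ex_max_on:
  fixes f :: "'b \<Rightarrow> real"
  assumes "finite A" "A \<noteq> {}"
  shows "\<exists>x\<in>A. \<forall>y\<in>A. f y \<le> f x"
proof -
  have "Max (f ` A) \<in> f ` A" using assms by simp
  then obtain x where "x \<in> A" "f x = Max (f ` A)" by auto
  then show ?thesis using assms by (intro bexI[of _ x]) auto
qed

section \<open>Pairs of roots, the dual system, and roots that are sums over a subsystem\<close>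

locale root_sys =
  fixes \<Phi> :: "'a::euclidean_space set"
  assumes root_system: "root_system \<Phi>"
begin

lemma finite_roots: "finite \<Phi>"
  and span_roots: "span \<Phi> = UNIV"
  and reflection_root: "\<alpha> \<in> \<Phi> \<Longrightarrow> \<beta> \<in> \<Phi> \<Longrightarrow> root_reflection \<beta> \<alpha> \<in> \<Phi>"
  and cartan_int: "\<alpha> \<in> \<Phi> \<Longrightarrow> \<beta> \<in> \<Phi> \<Longrightarrow> \<alpha> \<bullet> coroot \<beta> \<in> \<int>"
  and multiple_root: "\<alpha> \<in> \<Phi> \<Longrightarrow> c *\<^sub>R \<alpha> \<in> \<Phi> \<Longrightarrow> c = 1 \<or> c = - 1"
  using root_system unfolding root_system_def by auto

lemma root_nonzero: "\<alpha> \<in> \<Phi> \<Longrightarrow> \<alpha> \<noteq> 0"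
  using root_system unfolding root_system_def by auto

lemma inner_self_pos: "\<alpha> \<in> \<Phi> \<Longrightarrow> \<alpha> \<bullet> \<alpha> > 0"
  using root_nonzero by auto

lemma neg_root: "\<alpha> \<in> \<Phi> \<Longrightarrow> - \<alpha> \<in> \<Phi>"
  using reflection_root[of \<alpha> \<alpha>] root_nonzero[of \<alpha>]
  by (simp add: root_reflection_def inner_coroot scaleR_2)

text \<open>Equality would make the two roots proportional, and a reduced system allows only plus or
  minus. The vector \<open>x\<close> has squared length equal to the defect times the squared length
  of \<beta>.\<close>

lemma strict_cauchy_schwarz:
  assumes "\<alpha> \<in> \<Phi>" "\<beta> \<in> \<Phi>" "\<alpha> \<noteq> \<beta>" "\<alpha> \<noteq> - \<beta>"
  shows "(\<alpha> \<bullet> \<beta>)\<^sup>2 < (\<alpha> \<bullet> \<alpha>) * (\<beta> \<bullet> \<beta>)"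
proof (rule ccontr)
  define x where "x = (\<beta> \<bullet> \<beta>) *\<^sub>R \<alpha> - (\<alpha> \<bullet> \<beta>) *\<^sub>R \<beta>"
  have "x \<bullet> x = (\<beta> \<bullet> \<beta>) * ((\<alpha> \<bullet> \<alpha>) * (\<beta> \<bullet> \<beta>) - (\<alpha> \<bullet> \<beta>)\<^sup>2)"
    by (simp add: x_def algebra_simps inner_commute power2_eq_square)
  moreover assume "\<not> ?thesis"
  ultimately have "x \<bullet> x \<le> 0"
    using inner_self_pos[OF assms(2)] by (simp add: mult_nonneg_nonpos)
  then have "x = 0" by (metis inner_gt_zero_iff not_less)
  then have "(\<beta> \<bullet> \<beta>) *\<^sub>R \<alpha> = (\<alpha> \<bullet> \<beta>) *\<^sub>R \<beta>" by (simp add: x_def)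
  moreover have "\<alpha> = (1 / (\<beta> \<bullet> \<beta>)) *\<^sub>R (\<beta> \<bullet> \<beta>) *\<^sub>R \<alpha>"
    using inner_self_pos[OF assms(2)] by simp
  ultimately have "\<alpha> = ((\<alpha> \<bullet> \<beta>) / (\<beta> \<bullet> \<beta>)) *\<^sub>R \<beta>" by simp
  moreover from this have "((\<alpha> \<bullet> \<beta>) / (\<beta> \<bullet> \<beta>)) *\<^sub>R \<beta> \<in> \<Phi>" using assms(1) by simp
  ultimately show False using multiple_root[OF assms(2)] assms(3,4)
    by (metis scaleR_minus_left scaleR_one)
qed

text \<open>Strict Cauchy-Schwarz, with \<beta> at least as long as \<alpha>, squeezes this integer
  strictly between 0 and 2.\<close>

lemma cartan_eq_1:
  assumes "\<alpha> \<in> \<Phi>" "\<beta> \<in> \<Phi>" "\<alpha> \<noteq> \<beta>" "\<alpha> \<bullet> \<beta> > 0" "\<alpha> \<bullet> \<alpha> \<le> \<beta> \<bullet> \<beta>"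
  shows "\<alpha> \<bullet> coroot \<beta> = 1"
proof -
  let ?a = "\<alpha> \<bullet> \<alpha>" and ?b = "\<beta> \<bullet> \<beta>"
  have pos: "?a > 0" "?b > 0" using assms inner_self_pos by auto
  have "\<alpha> \<noteq> - \<beta>"
  proof
    assume "\<alpha> = - \<beta>"
    then have "\<alpha> \<bullet> \<beta> = - ?b" by simp
    with assms(4) pos(2) show False by linarith
  qed
  then have "(\<alpha> \<bullet> \<beta>)\<^sup>2 < ?a * ?b" using strict_cauchy_schwarz assms by blast
  also have "\<dots> \<le> ?b\<^sup>2" using assms(5) pos by (simp add: power2_eq_square)
  finally have "\<alpha> \<bullet> \<beta> < ?b" by (rule power2_less_imp_less) (use pos in simp)
  then have "\<alpha> \<bullet> coroot \<beta> < 2" "\<alpha> \<bullet> coroot \<beta> > 0"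
    using pos assms(4) by (simp_all add: inner_coroot field_simps)
  moreover obtain n where "\<alpha> \<bullet> coroot \<beta> = of_int n"
    using cartan_int[OF assms(1,2)] by (elim Ints_cases)
  ultimately show ?thesis by simp
qed

text \<open>Reflecting the shorter root in the longer one subtracts the latter exactly once; the
  cases only decide which root is shorter.\<close>

lemma diff_root:
  assumes "\<alpha> \<in> \<Phi>" "\<beta> \<in> \<Phi>" "\<alpha> \<noteq> \<beta>" "\<alpha> \<bullet> \<beta> > 0"
  shows "\<alpha> - \<beta> \<in> \<Phi>"
proof (cases "\<alpha> \<bullet> \<alpha> \<le> \<beta> \<bullet> \<beta>")
  case True
  then have "root_reflection \<beta> \<alpha> = \<alpha> - \<beta>"
    using cartan_eq_1[OF assms] by (simp add: root_reflection_def)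
  then show ?thesis using reflection_root assms by metis
next
  case False
  then have "root_reflection \<alpha> \<beta> = \<beta> - \<alpha>"
    using cartan_eq_1[of \<beta> \<alpha>] assms by (simp add: root_reflection_def inner_commute)
  then show ?thesis using reflection_root[of \<beta> \<alpha>] neg_root[of "\<beta> - \<alpha>"] assms by simp
qed

text \<open>Lets every statement about sums of roots be applied to coroots, where long and short are
  exchanged.\<close>

lemma root_system_dual: "root_system (coroot ` \<Phi>)"
proof -
  have "\<alpha> \<in> span (coroot ` \<Phi>)" if "\<alpha> \<in> \<Phi>" for \<alpha>
  proof -
    have "\<alpha> = ((\<alpha> \<bullet> \<alpha>) / 2) *\<^sub>R coroot \<alpha>"
      using root_nonzero[OF that] by (simp add: coroot_def)
    then show ?thesis using that by (metis imageI span_base span_scale)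
  qed
  then have "span \<Phi> \<subseteq> span (coroot ` \<Phi>)" by (intro span_minimal) auto
  moreover have "c = 1 \<or> c = - 1" if c: "\<alpha> \<in> \<Phi>" "c *\<^sub>R coroot \<alpha> \<in> coroot ` \<Phi>" for \<alpha> c
  proof -
    obtain \<beta> where \<beta>: "\<beta> \<in> \<Phi>" "c *\<^sub>R coroot \<alpha> = coroot \<beta>" using c(2) by auto
    have "\<beta> = coroot (c *\<^sub>R coroot \<alpha>)" by (simp add: \<beta>(2))
    also have "\<dots> = (1 / c) *\<^sub>R \<alpha>"
      using root_nonzero[OF c(1)] by (simp add: coroot_def power2_eq_square)
    finally have "1 / c = 1 \<or> 1 / c = - 1"
      by (metis multiple_root[OF c(1)] \<beta>(1))
    then show ?thesis by (metis div_by_1 divide_minus_right divide_divide_eq_right mult_1)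
  qed
  moreover have "coroot \<alpha> \<noteq> 0" if "\<alpha> \<in> \<Phi>" for \<alpha>
    using root_nonzero[OF that] by (simp add: coroot_def)
  ultimately show ?thesis
    using finite_roots span_roots reflection_root cartan_int
    unfolding root_system_def
    by (auto simp: root_reflection_coroot inner_commute simp flip: coroot_root_reflection)
qed

lemma neg_subsystem: "root_subsystem \<Phi> \<Psi> \<Longrightarrow> \<alpha> \<in> \<Psi> \<Longrightarrow> - \<alpha> \<in> \<Psi>"
  unfolding root_subsystem_def by blast

lemma root_subsystem_dual:
  assumes "root_subsystem \<Phi> \<Psi>"
  shows "root_subsystem (coroot ` \<Phi>) (coroot ` \<Psi>)"
  using assms unfolding root_subsystem_def
  by (auto simp: root_reflection_coroot simp flip: coroot_uminus coroot_root_reflection)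

lemma ex_summand_positive:
  assumes "\<alpha> \<in> \<Phi>" "\<alpha> = sum_list xs"
  shows "\<exists>\<beta>\<in>set xs. \<alpha> \<bullet> \<beta> > 0"
proof (rule ccontr)
  assume "\<not> ?thesis"
  then have "\<alpha> \<bullet> sum_list xs \<le> 0"
    by (induction xs) (auto simp: inner_add_right not_less intro: add_nonpos_nonpos)
  then have "\<alpha> \<bullet> \<alpha> \<le> 0" using assms(2) by simp
  with inner_self_pos[OF assms(1)] show False by linarith
qed

text \<open>Some summand \<beta> pairs positively with \<alpha>, so \<alpha> - \<beta> is a root
  with one summand fewer, and closedness restores \<alpha>. Applied to the dual system it shows that
  a proper closed set of coroots does not generate the coroot lattice.\<close>

lemma closed_contains_sums:
  assumes closed: "closed_in_roots \<Phi> \<Psi>" and sub: "\<Psi> \<subseteq> \<Phi>"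
    and "\<alpha> \<in> \<Phi>" "\<alpha> \<in> sums_of \<Psi>"
  shows "\<alpha> \<in> \<Psi>"
proof -
  obtain xs where "\<alpha> = sum_list xs" "set xs \<subseteq> \<Psi>"
    using assms(4) unfolding sums_of_def by auto
  then show ?thesis using \<open>\<alpha> \<in> \<Phi>\<close>
  proof (induction "length xs" arbitrary: xs \<alpha>)
    case 0
    then show ?case using root_nonzero by auto
  next
    case (Suc n)
    obtain \<beta> where \<beta>: "\<beta> \<in> set xs" "\<alpha> \<bullet> \<beta> > 0"
      using ex_summand_positive Suc.prems by blast
    show ?case
    proof (cases "\<alpha> = \<beta>")
      case False
      have "\<alpha> - \<beta> \<in> \<Phi>" using diff_root[of \<alpha> \<beta>] Suc.prems \<beta> False sub by auto
      moreover have "\<alpha> - \<beta> = sum_list (remove1 \<beta> xs)"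
        using Suc.prems(1) \<beta>(1) by (simp add: sum_list_map_remove1[of _ _ id, simplified])
      moreover have "set (remove1 \<beta> xs) \<subseteq> \<Psi>" "n = length (remove1 \<beta> xs)"
        using Suc.prems(2) Suc.hyps(2) \<beta>(1) set_remove1_subset[of \<beta> xs]
        by (auto simp: length_remove1)
      ultimately have "\<alpha> - \<beta> \<in> \<Psi>" using Suc.hyps(1) by blast
      then show ?thesis
        using closed Suc.prems \<beta>(1) unfolding closed_in_roots_def by force
    qed (use Suc.prems \<beta> in auto)
  qed
qed

text \<open>For \<alpha> no longer than the roots of \<Psi>, removing a summand \<beta> is the
  reflection in \<beta>. Hence stability under reflections replaces closedness, and the remaining
  root keeps the length of \<alpha>, as the induction requires.\<close>

lemma subsystem_contains_short_sums:
  assumes subsystem: "root_subsystem \<Phi> \<Psi>"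
    and "\<alpha> \<in> \<Phi>" "\<alpha> \<in> sums_of \<Psi>" and "\<And>\<beta>. \<beta> \<in> \<Psi> \<Longrightarrow> \<alpha> \<bullet> \<alpha> \<le> \<beta> \<bullet> \<beta>"
  shows "\<alpha> \<in> \<Psi>"
proof -
  obtain xs where "\<alpha> = sum_list xs" "set xs \<subseteq> \<Psi>"
    using assms(3) unfolding sums_of_def by auto
  then show ?thesis using \<open>\<alpha> \<in> \<Phi>\<close> assms(4)
  proof (induction "length xs" arbitrary: xs \<alpha>)
    case 0
    then show ?case using root_nonzero by auto
  next
    case (Suc n)
    obtain \<beta> where \<beta>: "\<beta> \<in> set xs" "\<alpha> \<bullet> \<beta> > 0"
      using ex_summand_positive Suc.prems by blast
    then have "\<beta> \<in> \<Psi>" using Suc.prems(2) by auto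
    then have "\<beta> \<in> \<Phi>" using subsystem unfolding root_subsystem_def by auto
    show ?case
    proof (cases "\<alpha> = \<beta>")
      case False
      have refl: "root_reflection \<beta> \<alpha> = \<alpha> - \<beta>"
        using cartan_eq_1[of \<alpha> \<beta>] Suc.prems \<beta> False \<open>\<beta> \<in> \<Psi>\<close> \<open>\<beta> \<in> \<Phi>\<close>
        by (auto simp: root_reflection_def)
      then have "\<alpha> - \<beta> \<in> \<Phi>" using reflection_root[of \<alpha> \<beta>] Suc.prems(3) \<open>\<beta> \<in> \<Phi>\<close> by simp
      moreover have "\<alpha> - \<beta> = sum_list (remove1 \<beta> xs)"
        using Suc.prems(1) \<beta>(1) by (simp add: sum_list_map_remove1[of _ _ id, simplified])
      moreover have "set (remove1 \<beta> xs) \<subseteq> \<Psi>" "n = length (remove1 \<beta> xs)"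
        using Suc.prems(2) Suc.hyps(2) \<beta>(1) set_remove1_subset[of \<beta> xs]
        by (auto simp: length_remove1)
      moreover have "(\<alpha> - \<beta>) \<bullet> (\<alpha> - \<beta>) = \<alpha> \<bullet> \<alpha>"
        using root_reflection_isometry[of \<beta> \<alpha> \<alpha>] refl by simp
      ultimately have "\<alpha> - \<beta> \<in> \<Psi>" using Suc.hyps(1) Suc.prems(4) by metis
      then have "root_reflection \<beta> (root_reflection \<beta> \<alpha>) \<in> \<Psi>"
        using subsystem \<open>\<beta> \<in> \<Psi>\<close> unfolding refl root_subsystem_def by blast
      then show ?thesis by simp
    qed (use \<open>\<beta> \<in> \<Psi>\<close> in simp)
  qed
qed

text \<open>If \<alpha> pairs positively with the longer root \<beta>, then \<alpha> \<bullet>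
  \<open>coroot\<close> \<beta> = 1, so the opposite Cartan integer is the ratio of squared lengths
  itself; Cauchy-Schwarz keeps it below 4.\<close>

lemma length_ratio:
  assumes "\<alpha> \<in> \<Phi>" "\<beta> \<in> \<Phi>" "\<alpha> \<bullet> \<beta> \<noteq> 0" "\<alpha> \<bullet> \<alpha> \<le> \<beta> \<bullet> \<beta>"
  shows "\<exists>r::nat. r \<in> {1, 2, 3} \<and> \<beta> \<bullet> \<beta> = real r * (\<alpha> \<bullet> \<alpha>)"
proof -
  have *: "\<exists>r::nat. r \<in> {1, 2, 3} \<and> \<beta> \<bullet> \<beta> = real r * (\<alpha> \<bullet> \<alpha>)"
    if \<alpha>: "\<alpha> \<in> \<Phi>" "\<alpha> \<bullet> \<beta> > 0" "\<alpha> \<bullet> \<alpha> \<le> \<beta> \<bullet> \<beta>" for \<alpha>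
  proof (cases "\<alpha> = \<beta>")
    case False
    have pos: "\<alpha> \<bullet> \<alpha> > 0" "\<beta> \<bullet> \<beta> > 0" using \<alpha>(1) assms(2) inner_self_pos by auto
    have "\<alpha> \<bullet> coroot \<beta> = 1" using cartan_eq_1[OF \<alpha>(1) assms(2) False \<alpha>(2,3)] .
    then have eq: "\<beta> \<bullet> \<beta> = 2 * (\<alpha> \<bullet> \<beta>)" using pos by (simp add: inner_coroot)
    have "\<alpha> \<noteq> - \<beta>"
    proof
      assume "\<alpha> = - \<beta>"
      then have "\<alpha> \<bullet> \<beta> = - (\<beta> \<bullet> \<beta>)" by simp
      with \<alpha>(2) pos(2) show False by linarith
    qed
    then have "(\<alpha> \<bullet> \<beta>) * (\<alpha> \<bullet> \<beta>) < (\<alpha> \<bullet> \<alpha>) * (2 * (\<alpha> \<bullet> \<beta>))"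
      using strict_cauchy_schwarz[OF \<alpha>(1) assms(2) False] by (simp add: power2_eq_square eq)
    then have "\<alpha> \<bullet> \<beta> < 2 * (\<alpha> \<bullet> \<alpha>)" using \<alpha>(2) by simp
    moreover obtain n where n: "\<beta> \<bullet> coroot \<alpha> = of_int n"
      using cartan_int[OF assms(2) \<alpha>(1)] by (elim Ints_cases)
    then have n_eq: "\<beta> \<bullet> \<beta> = of_int n * (\<alpha> \<bullet> \<alpha>)"
      using pos by (simp add: inner_coroot eq inner_commute field_simps)
    ultimately have "of_int n * (\<alpha> \<bullet> \<alpha>) < 4 * (\<alpha> \<bullet> \<alpha>)" "0 < of_int n * (\<alpha> \<bullet> \<alpha>)"
      using eq pos by linarith+
    then have "real_of_int n < 4" "0 < real_of_int n"
      using pos(1) mult_less_cancel_right_pos zero_less_mult_pos2 by blast+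
    then have n: "nat n \<in> {1, 2, 3}" "real_of_int n = real (nat n)" by auto
    have "\<beta> \<bullet> \<beta> = real (nat n) * (\<alpha> \<bullet> \<alpha>)" by (simp only: n_eq n(2))
    with n(1) show ?thesis by (intro exI[of _ "nat n"] conjI)
  qed (auto intro: exI[of _ 1])
  \<comment> \<open>Replacing \<alpha> by its negative makes the pairing positive without changing
    lengths.\<close>
  show ?thesis
    using *[of \<alpha>] *[of "- \<alpha>"] assms neg_root[of \<alpha>] by (cases "\<alpha> \<bullet> \<beta> > 0") auto
qed

lemma root_subsystem_integral: "root_subsystem \<Phi> {\<alpha> \<in> \<Phi>. v \<bullet> \<alpha> \<in> \<int>}"
  unfolding root_subsystem_def
  using neg_root reflection_root cartan_int
  by (auto simp: root_reflection_def inner_diff_right)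

text \<open>A reflection changes a coroot by an integral multiple of another coroot, so integrality
  of \<open>v\<close> is preserved.\<close>

lemma root_subsystem_integral_roots: "root_subsystem \<Phi> (integral_roots \<Phi> v)"
proof -
  have "v \<bullet> coroot (root_reflection \<beta> \<alpha>) \<in> \<int>"
    if "\<alpha> \<in> \<Phi>" "\<beta> \<in> \<Phi>" "v \<bullet> coroot \<alpha> \<in> \<int>" "v \<bullet> coroot \<beta> \<in> \<int>" for \<alpha> \<beta>
  proof -
    have "root_reflection \<beta> (coroot \<alpha>) = coroot \<alpha> - (\<beta> \<bullet> coroot \<alpha>) *\<^sub>R coroot \<beta>"
      unfolding root_reflection_coroot[symmetric, of \<beta>] by (simp add: root_reflection_def inner_commute)
    then show ?thesis
      using that cartan_int by (simp add: coroot_root_reflection inner_diff_right)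
  qed
  then show ?thesis
    unfolding root_subsystem_def integral_roots_def
    using neg_root reflection_root by (auto simp: coroot_uminus)
qed

end

lemma maximal_root_subsystem_eq:
  assumes "maximal_root_subsystem \<Phi> \<Psi>" "root_subsystem \<Phi> \<Psi>'" "\<Psi> \<subseteq> \<Psi>'" "\<Psi>' \<noteq> \<Phi>"
  shows "\<Psi> = \<Psi>'"
  using assms unfolding maximal_root_subsystem_def
  by (metis psubsetI root_subsystem_def)

section \<open>Root lengths in an irreducible system\<close>

locale irreducible_root_sys = root_sys +
  assumes irreducible: "irreducible_root_system \<Phi>"
begin

lemma roots_nonempty: "\<Phi> \<noteq> {}"
  using irreducible unfolding irreducible_root_system_def by blast

lemma not_orthogonal_union:
  assumes "A \<noteq> {}" "A \<subseteq> \<Phi>" "\<And>\<alpha> \<beta>. \<alpha> \<in> A \<Longrightarrow> \<beta> \<in> \<Phi> - A \<Longrightarrow> \<alpha> \<bullet> \<beta> = 0"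
  shows "A = \<Phi>"
proof (rule ccontr)
  assume "A \<noteq> \<Phi>"
  then have "A \<noteq> {} \<and> \<Phi> - A \<noteq> {} \<and> A \<union> (\<Phi> - A) = \<Phi> \<and> A \<inter> (\<Phi> - A) = {} \<and>
      (\<forall>\<alpha>\<in>A. \<forall>\<beta>\<in>\<Phi> - A. \<alpha> \<bullet> \<beta> = 0)"
    using assms by auto
  then have "\<exists>A B. A \<noteq> {} \<and> B \<noteq> {} \<and> A \<union> B = \<Phi> \<and> A \<inter> B = {} \<and> (\<forall>\<alpha>\<in>A. \<forall>\<beta>\<in>B. \<alpha> \<bullet> \<beta> = 0)"
    by (intro exI)
  with irreducible[unfolded irreducible_root_system_def, THEN conjunct2, THEN conjunct2]
  show False by (rule notE)
qed

text \<open>A root \<beta> outside the span of \<open>A\<close> is orthogonal to \<open>A\<close>,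
  because each reflection in \<beta> moves an element of \<open>A\<close> by a multiple of \<beta>.
  Irreducibility then leaves no such \<beta>.\<close>

lemma span_reflection_stable:
  assumes A: "A \<subseteq> \<Phi>" "A \<noteq> {}" and stable: "\<And>\<alpha> \<beta>. \<alpha> \<in> A \<Longrightarrow> \<beta> \<in> \<Phi> \<Longrightarrow> root_reflection \<beta> \<alpha> \<in> A"
  shows "span A = UNIV"
proof -
  have orth: "\<alpha> \<bullet> \<beta> = 0" if "\<alpha> \<in> A" "\<beta> \<in> \<Phi>" "\<beta> \<notin> span A" for \<alpha> \<beta>
  proof (rule ccontr)
    assume "\<alpha> \<bullet> \<beta> \<noteq> 0"
    then have c: "\<alpha> \<bullet> coroot \<beta> \<noteq> 0"
      using root_nonzero[OF that(2)] by (simp add: inner_coroot)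
    have "\<alpha> - root_reflection \<beta> \<alpha> \<in> span A"
      using stable[OF that(1,2)] that(1) by (intro span_diff span_base)
    then have "(\<alpha> \<bullet> coroot \<beta>) *\<^sub>R \<beta> \<in> span A" by (simp add: root_reflection_def)
    then have "\<beta> \<in> span A" using c span_scale[of "(\<alpha> \<bullet> coroot \<beta>) *\<^sub>R \<beta>" A "1 / (\<alpha> \<bullet> coroot \<beta>)"] by simp
    with that(3) show False by simp
  qed
  have "\<Phi> \<inter> span A = \<Phi>"
  proof (rule not_orthogonal_union)
    show "\<Phi> \<inter> span A \<noteq> {}" using A span_base by blast
    fix \<alpha> \<beta> assume "\<alpha> \<in> \<Phi> \<inter> span A" "\<beta> \<in> \<Phi> - \<Phi> \<inter> span A"
    then show "\<alpha> \<bullet> \<beta> = 0"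
      using orth orthogonal_to_span[of \<alpha> A \<beta>] by (auto simp: orthogonal_def inner_commute)
  qed auto
  then have "span \<Phi> \<subseteq> span A" by (intro span_minimal) auto
  then show ?thesis using span_roots by auto
qed

text \<open>A substitute for transitivity of the Weyl group on roots of one length: the set is
  stable under reflections, so it spans.\<close>

lemma span_roots_of_length:
  assumes "\<alpha> \<in> \<Phi>"
  shows "span {\<beta> \<in> \<Phi>. \<beta> \<bullet> \<beta> = \<alpha> \<bullet> \<alpha>} = UNIV"
  by (rule span_reflection_stable) (use assms in \<open>auto simp: reflection_root root_reflection_isometry\<close>)

text \<open>Orthogonal pairs are handled by exchanging \<alpha> for a root of the same length that
  is not orthogonal to \<beta>.\<close>

lemma length_ratio_ordered:
  assumes "\<alpha> \<in> \<Phi>" "\<beta> \<in> \<Phi>" "\<alpha> \<bullet> \<alpha> \<le> \<beta> \<bullet> \<beta>"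
  shows "\<exists>r::nat. r \<in> {1, 2, 3} \<and> \<beta> \<bullet> \<beta> = real r * (\<alpha> \<bullet> \<alpha>)"
proof -
  obtain \<gamma> where "\<gamma> \<in> \<Phi>" "\<gamma> \<bullet> \<gamma> = \<alpha> \<bullet> \<alpha>" "\<beta> \<bullet> \<gamma> \<noteq> 0"
    using orthogonal_to_spanning_set[OF span_roots_of_length[OF assms(1)], of \<beta>] root_nonzero[OF assms(2)]
    by auto
  then show ?thesis
    using length_ratio[of \<gamma> \<beta>] assms by (auto simp: inner_commute)
qed

text \<open>There are at most two lengths: three would give two ratios of at least 2 whose product
  is again a ratio, hence at most 3.\<close>

lemma shortest_or_longest:
  assumes "\<sigma> \<in> \<Phi>" "\<alpha> \<in> \<Phi>" "\<beta> \<in> \<Phi>" and \<sigma>: "\<And>\<gamma>. \<gamma> \<in> \<Phi> \<Longrightarrow> \<sigma> \<bullet> \<sigma> \<le> \<gamma> \<bullet> \<gamma>"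
    and "\<alpha> \<bullet> \<alpha> \<noteq> \<sigma> \<bullet> \<sigma>"
  shows "\<beta> \<bullet> \<beta> \<le> \<alpha> \<bullet> \<alpha>"
proof (rule ccontr)
  assume less: "\<not> ?thesis"
  obtain r s t :: nat where "\<alpha> \<bullet> \<alpha> = real r * (\<sigma> \<bullet> \<sigma>)" "\<beta> \<bullet> \<beta> = real s * (\<sigma> \<bullet> \<sigma>)"
    "\<beta> \<bullet> \<beta> = real t * (\<alpha> \<bullet> \<alpha>)" and rst: "r \<in> {1,2,3}" "s \<in> {1,2,3}" "t \<in> {1,2,3}"
    using length_ratio_ordered[OF assms(1,2) \<sigma>[OF assms(2)]]
      length_ratio_ordered[OF assms(1,3) \<sigma>[OF assms(3)]]
      length_ratio_ordered[OF assms(2,3)] less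
    by (metis linear)
  moreover have "\<sigma> \<bullet> \<sigma> > 0" using inner_self_pos[OF assms(1)] .
  ultimately have "real s = real (t * r)" "r \<noteq> 1" "t \<noteq> 1" using less assms(5) by auto
  then show False using rst by (auto simp del: of_nat_mult)
qed

lemma ex_shortest: "\<exists>\<sigma>\<in>\<Phi>. \<forall>\<gamma>\<in>\<Phi>. \<sigma> \<bullet> \<sigma> \<le> \<gamma> \<bullet> \<gamma>"
  using ex_max_on[OF finite_roots roots_nonempty, of "\<lambda>\<gamma>. - (\<gamma> \<bullet> \<gamma>)"] by auto

text \<open>The lattice of the subsystem detects the short roots, the lattice of its dual the long ones.\<close>

lemma subsystem_eq_if_lattices_full:
  assumes "root_subsystem \<Phi> \<Psi>" "\<Phi> \<subseteq> sums_of \<Psi>" "coroot ` \<Phi> \<subseteq> sums_of (coroot ` \<Psi>)"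
  shows "\<Psi> = \<Phi>"
proof -
  interpret dual: root_sys "coroot ` \<Phi>"
    by unfold_locales (rule root_system_dual)
  have sub: "\<Psi> \<subseteq> \<Phi>" using assms(1) by (simp add: root_subsystem_def)
  obtain \<sigma> where \<sigma>: "\<sigma> \<in> \<Phi>" "\<And>\<gamma>. \<gamma> \<in> \<Phi> \<Longrightarrow> \<sigma> \<bullet> \<sigma> \<le> \<gamma> \<bullet> \<gamma>" using ex_shortest by blast
  have "\<alpha> \<in> \<Psi>" if \<alpha>: "\<alpha> \<in> \<Phi>" for \<alpha>
  proof (cases "\<alpha> \<bullet> \<alpha> = \<sigma> \<bullet> \<sigma>")
    case True
    then show ?thesis
      using subsystem_contains_short_sums[OF assms(1) \<alpha>] assms(2) \<alpha> \<sigma>(2) sub by auto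
  next
    case False
    \<comment> \<open>A root that is not shortest is longest, so its coroot is shortest and the
      argument for short roots applies to the dual system.\<close>
    have "coroot \<alpha> \<in> coroot ` \<Psi>"
    proof (rule dual.subsystem_contains_short_sums[OF root_subsystem_dual[OF assms(1)]])
      fix \<beta> assume "\<beta> \<in> coroot ` \<Psi>"
      then obtain \<gamma> where \<gamma>: "\<beta> = coroot \<gamma>" "\<gamma> \<in> \<Phi>" using sub by auto
      have "\<gamma> \<bullet> \<gamma> \<le> \<alpha> \<bullet> \<alpha>" using shortest_or_longest[OF \<sigma>(1) \<alpha> \<gamma>(2) \<sigma>(2) False] by simp
      then show "coroot \<alpha> \<bullet> coroot \<alpha> \<le> \<beta> \<bullet> \<beta>"
        using inner_self_pos[OF \<gamma>(2)] unfolding \<gamma>(1) coroot_inner_self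
        by (intro divide_left_mono mult_pos_pos inner_self_pos[OF \<alpha>]) auto
    qed (use \<alpha> assms(3) in auto)
    then show ?thesis by (simp add: inj_image_mem_iff[OF inj_coroot])
  qed
  with sub show ?thesis by blast
qed

end

section \<open>Bases and the highest root\<close>

locale based_root_sys = root_sys \<Phi> for \<Phi> :: "'a::euclidean_space set" +
  fixes \<Delta> :: "'a set"
  assumes base: "root_base \<Phi> \<Delta>"
begin

lemma base_subset: "\<Delta> \<subseteq> \<Phi>" and independent_base: "independent \<Delta>"
  using base unfolding root_base_def by auto

lemma finite_base: "finite \<Delta>"
  using finite_subset[OF base_subset finite_roots] .

lemma span_base_eq: "span \<Delta> = UNIV"
proof -
  have "\<beta> \<in> span \<Delta>" if "\<beta> \<in> \<Phi>" for \<beta>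
  proof -
    obtain c :: "'a \<Rightarrow> nat" where
      "\<beta> = (\<Sum>\<alpha>\<in>\<Delta>. real (c \<alpha>) *\<^sub>R \<alpha>) \<or> \<beta> = - (\<Sum>\<alpha>\<in>\<Delta>. real (c \<alpha>) *\<^sub>R \<alpha>)"
      using base \<open>\<beta> \<in> \<Phi>\<close> unfolding root_base_def by blast
    moreover have "(\<Sum>\<alpha>\<in>\<Delta>. real (c \<alpha>) *\<^sub>R \<alpha>) \<in> span \<Delta>"
      by (intro span_sum span_scale span_base)
    ultimately show ?thesis using span_neg by metis
  qed
  then have "span \<Phi> \<subseteq> span \<Delta>" by (intro span_minimal) auto
  then show ?thesis using span_roots by auto
qed

abbreviation cf :: "'a \<Rightarrow> 'a \<Rightarrow> real" where "cf \<equiv> representation \<Delta>"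

lemma in_span_base: "x \<in> span \<Delta>"
  using span_base_eq by simp

lemma cf_add: "cf (x + y) a = cf x a + cf y a"
  and cf_diff: "cf (x - y) a = cf x a - cf y a"
  and cf_uminus: "cf (- x) a = - cf x a"
  and cf_scaleR: "cf (c *\<^sub>R x) a = c * cf x a"
  using representation_add[OF independent_base in_span_base in_span_base]
    representation_diff[OF independent_base in_span_base in_span_base]
    representation_neg[OF independent_base in_span_base]
    representation_scale[OF independent_base in_span_base]
  by simp_all

lemma cf_sum: "cf (sum f I) a = (\<Sum>i\<in>I. cf (f i) a)"
  using representation_sum[OF independent_base, of I f] in_span_base by simp

lemma cf_simple: "\<alpha> \<in> \<Delta> \<Longrightarrow> cf \<alpha> a = (if a = \<alpha> then 1 else 0)"
  using representation_basis[OF independent_base] by simp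

lemma cf_outside: "a \<notin> \<Delta> \<Longrightarrow> cf x a = 0"
  using representation_ne_zero by blast

lemmas expand = representation_expand[OF independent_base finite_base span_base_eq]

lemma inner_expand: "y \<bullet> x = (\<Sum>a\<in>\<Delta>. cf x a * (y \<bullet> a))"
  using arg_cong[OF expand[of x], of "inner y"] by (simp add: inner_sum_right)

lemma cf_int: "\<beta> \<in> \<Phi> \<Longrightarrow> cf \<beta> a \<in> \<int>"
  and cf_sign: "\<beta> \<in> \<Phi> \<Longrightarrow> (\<forall>a. cf \<beta> a \<ge> 0) \<or> (\<forall>a. cf \<beta> a \<le> 0)"
proof -
  assume "\<beta> \<in> \<Phi>"
  then obtain c :: "'a \<Rightarrow> nat" where c:
    "\<beta> = (\<Sum>\<alpha>\<in>\<Delta>. real (c \<alpha>) *\<^sub>R \<alpha>) \<or> \<beta> = - (\<Sum>\<alpha>\<in>\<Delta>. real (c \<alpha>) *\<^sub>R \<alpha>)"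
    using base unfolding root_base_def by blast
  have "cf (\<Sum>\<alpha>\<in>\<Delta>. real (c \<alpha>) *\<^sub>R \<alpha>) a = (if a \<in> \<Delta> then real (c a) else 0)" for a
  proof -
    have "cf (\<Sum>\<alpha>\<in>\<Delta>. real (c \<alpha>) *\<^sub>R \<alpha>) a = (\<Sum>\<alpha>\<in>\<Delta>. if \<alpha> = a then real (c \<alpha>) else 0)"
      unfolding cf_sum cf_scaleR by (intro sum.cong) (auto simp: cf_simple)
    then show ?thesis using finite_base by simp
  qed
  then have *: "(\<forall>a. cf \<beta> a = (if a \<in> \<Delta> then real (c a) else 0)) \<or>
      (\<forall>a. cf \<beta> a = - (if a \<in> \<Delta> then real (c a) else 0))"
    using c by (elim disjE) (simp_all add: cf_uminus)
  then have "cf \<beta> a \<in> {0, real (c a), - real (c a)}" by (auto split: if_splits)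
  then show "cf \<beta> a \<in> \<int>" by auto
  from * show "(\<forall>a. cf \<beta> a \<ge> 0) \<or> (\<forall>a. cf \<beta> a \<le> 0)" by (rule disj_forward) simp_all
qed

lemma inner_roots_int:
  assumes "\<beta> \<in> \<Phi>" "\<And>a. a \<in> \<Delta> \<Longrightarrow> c * (v \<bullet> a) \<in> \<int>"
  shows "c * (v \<bullet> \<beta>) \<in> \<int>"
proof -
  have eq: "c * (v \<bullet> \<beta>) = (\<Sum>a\<in>\<Delta>. cf \<beta> a * (c * (v \<bullet> a)))"
    by (subst inner_expand) (simp add: sum_distrib_left algebra_simps)
  have "cf \<beta> a * (c * (v \<bullet> a)) \<in> \<int>" if "a \<in> \<Delta>" for a
    using Ints_mult[OF cf_int[OF assms(1)] assms(2)[OF that]] .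
  then show ?thesis unfolding eq by (rule Ints_sum)
qed

definition pos_root :: "'a \<Rightarrow> bool" where
  "pos_root \<beta> \<longleftrightarrow> \<beta> \<in> \<Phi> \<and> (\<forall>a. cf \<beta> a \<ge> 0)"

lemma pos_root_in: "pos_root \<beta> \<Longrightarrow> \<beta> \<in> \<Phi>"
  by (simp add: pos_root_def)

lemma pos_or_neg_root: "\<beta> \<in> \<Phi> \<Longrightarrow> pos_root \<beta> \<or> pos_root (- \<beta>)"
  using cf_sign[of \<beta>] by (auto simp: pos_root_def cf_uminus neg_root)

lemma pos_root_if_cf_pos: "\<beta> \<in> \<Phi> \<Longrightarrow> cf \<beta> a > 0 \<Longrightarrow> pos_root \<beta>"
  using cf_sign[of \<beta>] unfolding pos_root_def by (meson not_less)

text \<open>As \<beta> \<bullet> \<beta> > 0, some simple root in the support pairs positively with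
  \<beta>; the support has a second element because the system is reduced. That second coefficient
  survives subtraction of multiples of \<alpha> and keeps the result positive.\<close>

lemma pos_root_reducible:
  assumes "pos_root \<beta>" "\<beta> \<notin> \<Delta>"
  shows "\<exists>\<alpha>\<in>\<Delta>. \<beta> \<bullet> \<alpha> > 0 \<and> (\<exists>a\<in>\<Delta>. a \<noteq> \<alpha> \<and> cf \<beta> a > 0)"
proof -
  have \<beta>: "\<beta> \<in> \<Phi>" "\<And>a. cf \<beta> a \<ge> 0" using assms(1) by (auto simp: pos_root_def)
  have "\<exists>\<alpha>\<in>\<Delta>. cf \<beta> \<alpha> * (\<beta> \<bullet> \<alpha>) > 0"
  proof (rule ccontr)
    assume "\<not> ?thesis"
    then have "(\<Sum>\<alpha>\<in>\<Delta>. cf \<beta> \<alpha> * (\<beta> \<bullet> \<alpha>)) \<le> 0" by (intro sum_nonpos) auto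
    then have "\<beta> \<bullet> \<beta> \<le> 0" using inner_expand[of \<beta> \<beta>] by simp
    with inner_self_pos[OF \<beta>(1)] show False by linarith
  qed
  then obtain \<alpha> where \<alpha>: "\<alpha> \<in> \<Delta>" "cf \<beta> \<alpha> * (\<beta> \<bullet> \<alpha>) > 0" by blast
  then have \<alpha>': "cf \<beta> \<alpha> > 0" "\<beta> \<bullet> \<alpha> > 0"
    using \<beta>(2)[of \<alpha>] by (auto simp: zero_less_mult_iff)
  have "\<exists>a\<in>\<Delta>. a \<noteq> \<alpha> \<and> cf \<beta> a > 0"
  proof (rule ccontr)
    assume "\<not> ?thesis"
    then have *: "cf \<beta> a = 0" if "a \<in> \<Delta>" "a \<noteq> \<alpha>" for a
      using \<beta>(2)[of a] that by force
    have "\<beta> = (\<Sum>a\<in>\<Delta>. if a = \<alpha> then cf \<beta> \<alpha> *\<^sub>R \<alpha> else 0)"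
      by (subst expand) (intro sum.cong, auto simp: *)
    also have "\<dots> = cf \<beta> \<alpha> *\<^sub>R \<alpha>" using finite_base \<alpha>(1) by simp
    finally have eq: "\<beta> = cf \<beta> \<alpha> *\<^sub>R \<alpha>" .
    then have "cf \<beta> \<alpha> = 1 \<or> cf \<beta> \<alpha> = - 1"
      using multiple_root[of \<alpha> "cf \<beta> \<alpha>"] \<beta>(1) \<alpha>(1) base_subset by auto
    then have "\<beta> = \<alpha>" using \<alpha>'(1) eq by auto
    with assms(2) \<alpha>(1) show False by simp
  qed
  with \<alpha> \<alpha>' show ?thesis by blast
qed

definition height :: "'a \<Rightarrow> real" where
  "height \<beta> = (\<Sum>a\<in>\<Delta>. cf \<beta> a)"

lemma height_simple: "\<alpha> \<in> \<Delta> \<Longrightarrow> height (\<beta> - c *\<^sub>R \<alpha>) = height \<beta> - c"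
  using finite_base by (simp add: height_def cf_diff cf_scaleR cf_simple sum_subtractf flip: sum_distrib_left)

text \<open>Allowing every positive \<open>c\<close> for which the difference is a root covers both
  subtraction of \<alpha> and reflection in \<alpha> by one rule.\<close>

lemma pos_root_induct [consumes 1, case_names simple step]:
  assumes "pos_root \<beta>" and "\<And>\<alpha>. \<alpha> \<in> \<Delta> \<Longrightarrow> P \<alpha>"
    and step: "\<And>\<beta> \<alpha>. pos_root \<beta> \<Longrightarrow> \<beta> \<notin> \<Delta> \<Longrightarrow> \<alpha> \<in> \<Delta> \<Longrightarrow> \<beta> \<bullet> \<alpha> > 0 \<Longrightarrow>
      (\<And>c. c > 0 \<Longrightarrow> \<beta> - c *\<^sub>R \<alpha> \<in> \<Phi> \<Longrightarrow> pos_root (\<beta> - c *\<^sub>R \<alpha>) \<and> P (\<beta> - c *\<^sub>R \<alpha>)) \<Longrightarrow> P \<beta>"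
  shows "P \<beta>"
  using assms(1)
proof (induction "nat \<lfloor>height \<beta>\<rfloor>" arbitrary: \<beta> rule: less_induct)
  case less
  show ?case
  proof (cases "\<beta> \<in> \<Delta>")
    case False
    then obtain \<alpha> a where \<alpha>: "\<alpha> \<in> \<Delta>" "\<beta> \<bullet> \<alpha> > 0" "a \<in> \<Delta>" "a \<noteq> \<alpha>" "cf \<beta> a > 0"
      using pos_root_reducible[OF less.prems] by blast
    have "pos_root (\<beta> - c *\<^sub>R \<alpha>) \<and> P (\<beta> - c *\<^sub>R \<alpha>)" if c: "c > 0" "\<beta> - c *\<^sub>R \<alpha> \<in> \<Phi>" for c
    proof -
      let ?\<gamma> = "\<beta> - c *\<^sub>R \<alpha>"
      have pos: "pos_root ?\<gamma>"
        using pos_root_if_cf_pos[OF c(2), of a] \<alpha> by (simp add: cf_diff cf_scaleR cf_simple)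
      have ints: "height ?\<gamma> \<in> \<int>" "height \<beta> \<in> \<int>"
        using cf_int c(2) pos_root_in[OF less.prems] unfolding height_def by (auto intro!: Ints_sum)
      have "height ?\<gamma> \<ge> 0"
        using pos unfolding height_def pos_root_def by (auto intro!: sum_nonneg)
      moreover have "height ?\<gamma> < height \<beta>" using height_simple[OF \<alpha>(1)] c(1) by simp
      ultimately have "nat \<lfloor>height ?\<gamma>\<rfloor> < nat \<lfloor>height \<beta>\<rfloor>"
        using ints by (auto elim!: Ints_cases)
      with less.hyps pos show ?thesis by blast
    qed
    with step less.prems False \<alpha> show ?thesis by blast
  qed (use assms(2) in simp)
qed

section \<open>The basis of simple coroots\<close>

lemma independent_coroot_base: "independent (coroot ` \<Delta>)"
  and span_coroot_base: "span (coroot ` \<Delta>) = UNIV"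
proof -
  have "\<alpha> \<in> span (coroot ` \<Delta>)" if "\<alpha> \<in> \<Delta>" for \<alpha>
  proof -
    have "\<alpha> = ((\<alpha> \<bullet> \<alpha>) / 2) *\<^sub>R coroot \<alpha>"
      using that base_subset root_nonzero by (auto simp: coroot_def)
    then show ?thesis using that by (metis imageI span_base span_scale)
  qed
  then have "span \<Delta> \<subseteq> span (coroot ` \<Delta>)" by (intro span_minimal) auto
  then show span: "span (coroot ` \<Delta>) = UNIV" using span_base_eq by auto
  have "card (coroot ` \<Delta>) \<le> card \<Delta>" using finite_base by (rule card_image_le)
  also have "\<dots> = dim (UNIV :: 'a set)"
    using dim_span_eq_card_independent[OF independent_base] span_base_eq by simp
  finally show "independent (coroot ` \<Delta>)"
    using card_le_dim_spanning[of "coroot ` \<Delta>" UNIV] span finite_base by simp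
qed

lemma finite_coroot_base: "finite (coroot ` \<Delta>)"
  using finite_base by simp

text \<open>Descent by simple reflections: the coroots of \<beta> and of its reflection in \<alpha>
  differ by an integral multiple of the simple coroot of \<alpha>. Only integrality is needed later,
  so signs are not tracked.\<close>

lemma coroot_representation_int:
  assumes "\<beta> \<in> \<Phi>"
  shows "representation (coroot ` \<Delta>) (coroot \<beta>) b \<in> \<int>"
proof -
  let ?r = "representation (coroot ` \<Delta>)"
  have in_span: "x \<in> span (coroot ` \<Delta>)" for x using span_coroot_base by simp
  note r = representation_add[OF independent_coroot_base in_span in_span]
    representation_scale[OF independent_coroot_base in_span]
    representation_neg[OF independent_coroot_base in_span]
  have *: "\<forall>b. ?r (coroot \<beta>) b \<in> \<int>" if "pos_root \<beta>" for \<beta>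
    using that
  proof (induction rule: pos_root_induct)
    case (simple \<alpha>)
    then show ?case by (simp add: representation_basis[OF independent_coroot_base])
  next
    case (step \<beta> \<alpha>)
    have \<alpha>: "\<alpha> \<in> \<Phi>" and \<beta>: "\<beta> \<in> \<Phi>" using step base_subset by (auto simp: pos_root_def)
    have "\<beta> \<bullet> coroot \<alpha> > 0" using step(4) inner_self_pos[OF \<alpha>] by (simp add: inner_coroot)
    moreover have refl: "root_reflection \<alpha> \<beta> = \<beta> - (\<beta> \<bullet> coroot \<alpha>) *\<^sub>R \<alpha>"
      by (simp add: root_reflection_def)
    ultimately have IH: "?r (coroot (root_reflection \<alpha> \<beta>)) b \<in> \<int>" for b
      using step(5)[of "\<beta> \<bullet> coroot \<alpha>"] reflection_root[OF \<beta> \<alpha>] by simp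
    have "coroot \<beta> = coroot (root_reflection \<alpha> \<beta>) + (coroot \<beta> \<bullet> \<alpha>) *\<^sub>R coroot \<alpha>"
      unfolding coroot_root_reflection root_reflection_coroot[symmetric, of \<alpha>]
      by (simp add: root_reflection_def)
    then have "?r (coroot \<beta>) b =
        ?r (coroot (root_reflection \<alpha> \<beta>)) b + (\<alpha> \<bullet> coroot \<beta>) * ?r (coroot \<alpha>) b" for b
      using r by (metis inner_commute)
    moreover have "?r (coroot \<alpha>) b \<in> \<int>" for b
      using step(3) by (simp add: representation_basis[OF independent_coroot_base])
    ultimately show ?case using IH cartan_int[OF \<alpha> \<beta>] by auto
  qed
  show ?thesis
    using pos_or_neg_root[OF assms] *[of \<beta>] *[of "- \<beta>"] by (auto simp: coroot_uminus r)
qed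

lemma inner_simple_nonpos:
  assumes "\<alpha> \<in> \<Delta>" "\<beta> \<in> \<Delta>" "\<alpha> \<noteq> \<beta>"
  shows "\<alpha> \<bullet> \<beta> \<le> 0"
proof (rule ccontr)
  assume "\<not> ?thesis"
  then have "\<alpha> - \<beta> \<in> \<Phi>" using diff_root[of \<alpha> \<beta>] assms base_subset by auto
  from cf_sign[OF this] show False
  proof
    assume "\<forall>a. 0 \<le> cf (\<alpha> - \<beta>) a"
    from spec[OF this, of \<beta>] show False using assms by (simp add: cf_diff cf_simple)
  next
    assume "\<forall>a. cf (\<alpha> - \<beta>) a \<le> 0"
    from spec[OF this, of \<alpha>] show False using assms by (simp add: cf_diff cf_simple)
  qed
qed

end

section \<open>Connectedness of the base and uniqueness of the highest root\<close>

locale irreducible_based_root_sys = irreducible_root_sys \<Phi> + based_root_sys \<Phi> \<Delta>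
  for \<Phi> \<Delta> :: "'a::euclidean_space set"
begin

text \<open>Irreducibility passes from roots to the base: by descent every positive root lies in the
  span of \<open>D\<close> or of its complement, so an orthogonal splitting of the base would split
  \<Phi>.\<close>

lemma base_not_orthogonal_union:
  assumes "D \<subseteq> \<Delta>" "D \<noteq> {}" and orth: "\<And>\<alpha> \<beta>. \<alpha> \<in> D \<Longrightarrow> \<beta> \<in> \<Delta> - D \<Longrightarrow> \<alpha> \<bullet> \<beta> = 0"
  shows "D = \<Delta>"
proof -
  define E where "E = \<Delta> - D"
  have span_orth: "x \<bullet> y = 0" if "x \<in> span D" "y \<in> span E" for x y
  proof -
    have "orthogonal y a" if "a \<in> D" for a
    proof -
      have "orthogonal a e" if "e \<in> E" for e
        using orth[OF \<open>a \<in> D\<close>] that by (simp add: orthogonal_def E_def)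
      then show ?thesis
        using orthogonal_to_span[OF \<open>y \<in> span E\<close>] orthogonal_commute by blast
    qed
    then show ?thesis
      using orthogonal_to_span[OF \<open>x \<in> span D\<close>, of y] by (simp add: orthogonal_def inner_commute)
  qed
  have cf_zero: "cf x a = 0" if "x \<in> span D'" "D' \<subseteq> \<Delta>" "a \<notin> D'" for x a D'
    using representation_extend[OF independent_base that(1,2)] representation_ne_zero[of D' x a] that(3)
    by metis
  \<comment> \<open>The mixed case \<beta> = \<gamma> + \<alpha> with \<gamma> in the span of
    \<open>D'\<close> and \<alpha> orthogonal to it is impossible: reflection in \<alpha> gives
    \<beta> - 2\<alpha>, which must be positive although \<alpha> has coefficient 1 in \<beta>.
    \<open>D'\<close> stands for \<open>D\<close> or \<open>E\<close>.\<close>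
  have descend: "\<beta> \<in> span D'"
    if \<beta>: "pos_root \<beta>" and \<alpha>: "\<alpha> \<in> \<Delta>" and IH: "\<beta> - \<alpha> \<in> span D'" "\<alpha> \<notin> D' \<Longrightarrow> (\<beta> - \<alpha>) \<bullet> \<alpha> = 0" and D': "D' \<subseteq> \<Delta>"
      and down: "\<And>c. c > 0 \<Longrightarrow> \<beta> - c *\<^sub>R \<alpha> \<in> \<Phi> \<Longrightarrow> pos_root (\<beta> - c *\<^sub>R \<alpha>)"
    for \<beta> \<alpha> D'
  proof (cases "\<alpha> \<in> D'")
    case True
    then show ?thesis using span_add[OF IH(1) span_base[OF True]] by simp
  next
    case False
    have "\<beta> \<bullet> \<alpha> = \<alpha> \<bullet> \<alpha>" using IH(2)[OF False] by (simp add: inner_diff_left)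
    then have "\<beta> \<bullet> coroot \<alpha> = 2"
      using root_nonzero[of \<alpha>] \<alpha> base_subset by (auto simp: inner_coroot)
    then have "root_reflection \<alpha> \<beta> = \<beta> - 2 *\<^sub>R \<alpha>" by (simp add: root_reflection_def)
    then have "pos_root (\<beta> - 2 *\<^sub>R \<alpha>)"
      using down[of 2] reflection_root[of \<beta> \<alpha>] \<alpha> base_subset pos_root_in[OF \<beta>] by auto
    then have "cf \<beta> \<alpha> \<ge> 2"
      unfolding pos_root_def cf_diff cf_scaleR by (metis \<alpha> cf_simple diff_ge_0_iff_ge mult.right_neutral)
    moreover have "cf \<beta> \<alpha> = 1"
      using cf_zero[OF IH(1) D' False] \<alpha> by (simp add: cf_diff cf_simple)
    ultimately show ?thesis by simp
  qed
  have pos: "\<beta> \<in> span D \<or> \<beta> \<in> span E" if "pos_root \<beta>" for \<beta>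
    using that
  proof (induction rule: pos_root_induct)
    case (simple \<alpha>)
    then show ?case by (cases "\<alpha> \<in> D") (auto simp: E_def intro: span_base)
  next
    case (step \<beta> \<alpha>)
    have "\<beta> - \<alpha> \<in> \<Phi>"
      using diff_root[of \<beta> \<alpha>] step pos_root_in base_subset by auto
    then have "\<beta> - \<alpha> \<in> span D \<or> \<beta> - \<alpha> \<in> span E" using step(5)[of 1] by simp
    then show ?case
    proof
      assume *: "\<beta> - \<alpha> \<in> span D"
      have "\<alpha> \<in> span E" if "\<alpha> \<notin> D" using that step(3) by (auto simp: E_def intro: span_base)
      then have "\<beta> \<in> span D"
        using descend[of \<beta> \<alpha> D] step * span_orth assms(1) by blast
      then show ?thesis ..
    next
      assume *: "\<beta> - \<alpha> \<in> span E"
      have "\<alpha> \<in> span D" if "\<alpha> \<notin> E" using that step(3) by (auto simp: E_def intro: span_base)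
      then have "\<beta> \<in> span E"
        using descend[of \<beta> \<alpha> E] step * span_orth by (metis E_def Diff_subset inner_commute)
      then show ?thesis ..
    qed
  qed
  have split: "\<beta> \<in> span D \<or> \<beta> \<in> span E" if "\<beta> \<in> \<Phi>" for \<beta>
    using pos_or_neg_root[OF that] pos[of \<beta>] pos[of "- \<beta>"] span_neg[of "- \<beta>"] by auto
  have "\<Phi> \<inter> span D = \<Phi>"
  proof (rule not_orthogonal_union)
    show "\<Phi> \<inter> span D \<noteq> {}" using assms base_subset span_base by blast
    fix \<alpha> \<beta> assume "\<alpha> \<in> \<Phi> \<inter> span D" "\<beta> \<in> \<Phi> - \<Phi> \<inter> span D"
    then show "\<alpha> \<bullet> \<beta> = 0" using split span_orth by blast
  qed auto
  have "E = {}"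
  proof (rule ccontr)
    assume "E \<noteq> {}"
    then obtain \<alpha> where "\<alpha> \<in> E" by blast
    then have "\<alpha> \<in> span E" "\<alpha> \<in> \<Phi>" using base_subset by (auto simp: E_def intro: span_base)
    then have "\<alpha> \<bullet> \<alpha> = 0" using span_orth[of \<alpha> \<alpha>] \<open>\<Phi> \<inter> span D = \<Phi>\<close> by blast
    with inner_self_pos[OF \<open>\<alpha> \<in> \<Phi>\<close>] show False by simp
  qed
  with assms(1) show ?thesis by (auto simp: E_def)
qed

text \<open>Maximal only for the coefficientwise order. Existence is then a matter of finiteness,
  and uniqueness turns a maximal root into the greatest one.\<close>

definition maximal_root :: "'a \<Rightarrow> bool" where
  "maximal_root \<theta> \<longleftrightarrow> \<theta> \<in> \<Phi> \<and> (\<forall>\<gamma>\<in>\<Phi>. (\<forall>a. cf \<theta> a \<le> cf \<gamma> a) \<longrightarrow> \<gamma> = \<theta>)"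

lemma eq_if_cf_eq: "(\<And>a. a \<in> \<Delta> \<Longrightarrow> cf x a = cf y a) \<Longrightarrow> x = y"
  using expand[of x] expand[of y] by (metis (no_types, lifting) sum.cong)

lemma ex_maximal_root_above:
  assumes "\<beta> \<in> \<Phi>"
  shows "\<exists>\<theta>. maximal_root \<theta> \<and> (\<forall>a. cf \<beta> a \<le> cf \<theta> a)"
proof -
  let ?U = "{\<gamma> \<in> \<Phi>. \<forall>a. cf \<beta> a \<le> cf \<gamma> a}"
  have "finite ?U" "?U \<noteq> {}" using finite_roots assms by auto
  then obtain \<theta> where \<theta>: "\<theta> \<in> ?U" "\<And>\<gamma>. \<gamma> \<in> ?U \<Longrightarrow> height \<gamma> \<le> height \<theta>"
    using ex_max_on[of ?U height] by blast
  have "\<gamma> = \<theta>" if \<gamma>: "\<gamma> \<in> \<Phi>" "\<forall>a. cf \<theta> a \<le> cf \<gamma> a" for \<gamma>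
  proof -
    have "\<gamma> \<in> ?U" using \<theta>(1) \<gamma> by (auto intro: order_trans)
    then have "height \<gamma> \<le> height \<theta>" by (rule \<theta>(2))
    then have "(\<Sum>a\<in>\<Delta>. cf \<gamma> a - cf \<theta> a) \<le> 0" by (simp add: height_def sum_subtractf)
    moreover have "(\<Sum>a\<in>\<Delta>. cf \<gamma> a - cf \<theta> a) \<ge> 0" using \<gamma>(2) by (intro sum_nonneg) simp
    ultimately have "(\<Sum>a\<in>\<Delta>. cf \<gamma> a - cf \<theta> a) = 0" by linarith
    then have "\<forall>a\<in>\<Delta>. cf \<gamma> a - cf \<theta> a = 0"
      using sum_nonneg_eq_0_iff[OF finite_base, of "\<lambda>a. cf \<gamma> a - cf \<theta> a"] \<gamma>(2) by simp
    then show ?thesis by (intro eq_if_cf_eq) simp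
  qed
  with \<theta>(1) show ?thesis unfolding maximal_root_def by auto
qed

text \<open>A negative pairing would make \<theta> + \<alpha> a larger root, or \<theta> the
  negative of \<alpha>, which lies below \<alpha>.\<close>

lemma maximal_root_dominant:
  assumes "maximal_root \<theta>" "\<alpha> \<in> \<Delta>"
  shows "\<theta> \<bullet> \<alpha> \<ge> 0"
proof (rule ccontr)
  assume less: "\<not> ?thesis"
  have \<theta>: "\<theta> \<in> \<Phi>" and \<alpha>: "\<alpha> \<in> \<Phi>" using assms base_subset by (auto simp: maximal_root_def)
  have "\<theta> + \<alpha> \<in> \<Phi> \<or> \<theta> = - \<alpha>"
    using diff_root[OF \<theta> neg_root[OF \<alpha>]] less by auto
  then show False
  proof
    assume "\<theta> + \<alpha> \<in> \<Phi>"
    moreover have "\<forall>a. cf \<theta> a \<le> cf (\<theta> + \<alpha>) a" using assms(2) by (simp add: cf_add cf_simple)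
    ultimately have "\<theta> + \<alpha> = \<theta>" using assms(1) unfolding maximal_root_def by blast
    then show False using root_nonzero[OF \<alpha>] by simp
  next
    assume *: "\<theta> = - \<alpha>"
    then have "\<forall>a. cf \<theta> a \<le> cf \<alpha> a" using assms(2) by (simp add: cf_uminus cf_simple)
    then have "\<alpha> = \<theta>" using assms(1) \<alpha> unfolding maximal_root_def by blast
    then have "cf \<alpha> \<alpha> = cf (- \<alpha>) \<alpha>" using * by simp
    then show False using assms(2) by (simp add: cf_uminus cf_simple)
  qed
qed

text \<open>A simple root outside the support pairs nonpositively with each term of \<theta>, yet
  nonnegatively with \<theta> by dominance. It is therefore orthogonal to the support, which by
  connectedness is the whole base.\<close>

lemma maximal_root_full_support:
  assumes "maximal_root \<theta>"
  shows "\<forall>\<alpha>\<in>\<Delta>. cf \<theta> \<alpha> > 0"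
proof -
  have \<theta>: "\<theta> \<in> \<Phi>" using assms by (simp add: maximal_root_def)
  have nonneg: "cf \<theta> a \<ge> 0" for a
  proof (rule ccontr)
    assume "\<not> ?thesis"
    then have "\<forall>a. cf \<theta> a \<le> 0" using cf_sign[OF \<theta>] by (meson le_cases)
    then have "\<theta> \<bullet> \<theta> \<le> 0"
      using maximal_root_dominant[OF assms]
      by (subst inner_expand) (auto intro!: sum_nonpos mult_nonpos_nonneg)
    with inner_self_pos[OF \<theta>] show False by linarith
  qed
  define D where "D = {a \<in> \<Delta>. cf \<theta> a > 0}"
  have "D \<noteq> {}"
  proof
    assume "D = {}"
    then have "cf \<theta> a = 0" if "a \<in> \<Delta>" for a using nonneg[of a] that by (auto simp: D_def)
    then have "\<theta> = 0" by (subst expand) simp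
    with root_nonzero[OF \<theta>] show False by simp
  qed
  moreover have "\<alpha> \<bullet> \<beta> = 0" if \<alpha>: "\<alpha> \<in> D" and \<beta>: "\<beta> \<in> \<Delta> - D" for \<alpha> \<beta>
  proof -
    have \<beta>0: "cf \<theta> \<beta> = 0" using \<beta> nonneg[of \<beta>] by (auto simp: D_def)
    have terms: "cf \<theta> a * (\<beta> \<bullet> a) \<le> 0" if "a \<in> \<Delta>" for a
    proof (cases "a = \<beta>")
      case False
      then show ?thesis using nonneg inner_simple_nonpos[of \<beta> a] \<beta> that by (auto intro: mult_nonneg_nonpos)
    qed (simp add: \<beta>0)
    have "0 \<le> \<beta> \<bullet> \<theta>" using maximal_root_dominant[OF assms, of \<beta>] \<beta> by (simp add: inner_commute)
    then have "(\<Sum>a\<in>\<Delta>. - (cf \<theta> a * (\<beta> \<bullet> a))) \<le> 0"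
      by (subst (asm) inner_expand) (simp add: sum_negf)
    moreover have "(\<Sum>a\<in>\<Delta>. - (cf \<theta> a * (\<beta> \<bullet> a))) \<ge> 0" using terms by (intro sum_nonneg) simp
    ultimately have "(\<Sum>a\<in>\<Delta>. - (cf \<theta> a * (\<beta> \<bullet> a))) = 0" by linarith
    then have "- (cf \<theta> \<alpha> * (\<beta> \<bullet> \<alpha>)) = 0"
      using sum_nonneg_eq_0_iff[OF finite_base, of "\<lambda>a. - (cf \<theta> a * (\<beta> \<bullet> a))"] terms \<alpha>
      by (auto simp: D_def)
    then show ?thesis using \<alpha> by (auto simp: D_def inner_commute)
  qed
  ultimately have "D = \<Delta>" by (intro base_not_orthogonal_union) (auto simp: D_def)
  then show ?thesis by (auto simp: D_def)
qed

text \<open>Dominance and full support make two maximal roots pair positively. Their difference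
  would be a root, whose coefficients have one sign, so the two would be comparable.\<close>

lemma maximal_root_unique:
  assumes "maximal_root \<theta>" "maximal_root \<theta>'"
  shows "\<theta> = \<theta>'"
proof (rule ccontr)
  assume "\<theta> \<noteq> \<theta>'"
  have \<theta>: "\<theta> \<in> \<Phi>" "\<theta>' \<in> \<Phi>" using assms by (auto simp: maximal_root_def)
  have "\<exists>a\<in>\<Delta>. \<theta> \<bullet> a \<noteq> 0"
    using orthogonal_to_spanning_set[OF span_base_eq, of \<theta>] root_nonzero[OF \<theta>(1)] by blast
  then obtain a where a: "a \<in> \<Delta>" "\<theta> \<bullet> a > 0"
    using maximal_root_dominant[OF assms(1)] by force
  have "\<theta> \<bullet> \<theta>' = (\<Sum>b\<in>\<Delta>. cf \<theta>' b * (\<theta> \<bullet> b))" by (rule inner_expand)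
  also have "\<dots> \<ge> cf \<theta>' a * (\<theta> \<bullet> a)"
  proof (rule member_le_sum[OF a(1) _ finite_base])
    fix b assume "b \<in> \<Delta> - {a}"
    then show "0 \<le> cf \<theta>' b * (\<theta> \<bullet> b)"
      using maximal_root_full_support[OF assms(2)] maximal_root_dominant[OF assms(1)]
      by (intro mult_nonneg_nonneg) (auto intro: less_imp_le)
  qed
  moreover have "cf \<theta>' a * (\<theta> \<bullet> a) > 0"
    using a maximal_root_full_support[OF assms(2)] by simp
  ultimately have "\<theta> \<bullet> \<theta>' > 0" by linarith
  then have "\<theta> - \<theta>' \<in> \<Phi>" using diff_root \<theta> \<open>\<theta> \<noteq> \<theta>'\<close> by blast
  then have "(\<forall>a. cf \<theta>' a \<le> cf \<theta> a) \<or> (\<forall>a. cf \<theta> a \<le> cf \<theta>' a)"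
    using cf_sign[of "\<theta> - \<theta>'"] by (simp add: cf_diff)
  then show False using assms \<theta> \<open>\<theta> \<noteq> \<theta>'\<close> unfolding maximal_root_def by metis
qed

lemma highest_root:
  shows highest_root_in: "highest_root \<Phi> \<Delta> \<in> \<Phi>"
    and highest_root_ge: "\<beta> \<in> \<Phi> \<Longrightarrow> cf \<beta> a \<le> cf (highest_root \<Phi> \<Delta>) a"
proof -
  obtain \<theta> where \<theta>: "maximal_root \<theta>" using ex_maximal_root_above roots_nonempty by blast
  have ge: "cf \<beta> a \<le> cf \<theta> a" if "\<beta> \<in> \<Phi>" for \<beta> a
    using ex_maximal_root_above[OF that] maximal_root_unique[OF \<theta>] by blast
  have "highest_root \<Phi> \<Delta> = \<theta>"
    unfolding highest_root_def
  proof (rule the_equality)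
    show "\<theta> \<in> \<Phi> \<and> (\<forall>\<beta>\<in>\<Phi>. \<forall>\<alpha>\<in>\<Delta>. cf \<beta> \<alpha> \<le> cf \<theta> \<alpha>)"
      using ge \<theta> by (simp add: maximal_root_def)
    fix \<theta>' assume *: "\<theta>' \<in> \<Phi> \<and> (\<forall>\<beta>\<in>\<Phi>. \<forall>\<alpha>\<in>\<Delta>. cf \<beta> \<alpha> \<le> cf \<theta>' \<alpha>)"
    then have "cf \<theta> a \<le> cf \<theta>' a" for a
      using \<theta> cf_outside[of a] by (cases "a \<in> \<Delta>") (auto simp: maximal_root_def)
    then show "\<theta>' = \<theta>" using * \<theta> unfolding maximal_root_def by blast
  qed
  then show "highest_root \<Phi> \<Delta> \<in> \<Phi>" "\<beta> \<in> \<Phi> \<Longrightarrow> cf \<beta> a \<le> cf (highest_root \<Phi> \<Delta>) a"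
    using \<theta> ge by (auto simp: maximal_root_def)
qed

subsection \<open>Integral subsystems of full rank\<close>

abbreviation \<theta> :: 'a where "\<theta> \<equiv> highest_root \<Phi> \<Delta>"

lemma cf_highest_root_ge_1: "a \<in> \<Delta> \<Longrightarrow> cf \<theta> a \<ge> 1"
  using highest_root_ge[of a a] base_subset by (auto simp: cf_simple)

text \<open>Such an \<open>x\<close> is determined by its scaled pairings with the roots, which are
  integers bounded by Cauchy-Schwarz. This makes the minimum of the norm attained in the alcove
  argument.\<close>

lemma bounded_coweights_finite:
  "finite {x. (\<forall>\<alpha>\<in>\<Phi>. of_int p * (x \<bullet> \<alpha>) \<in> \<int>) \<and> norm x \<le> R}" (is "finite ?X") if "p \<noteq> 0"
proof -
  define f where "f = (\<lambda>x. \<lambda>\<alpha>\<in>\<Phi>. \<lfloor>of_int p * (x \<bullet> \<alpha>)\<rfloor>)"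
  define K where "K = (\<lambda>\<alpha>::'a. \<bar>of_int p\<bar> * (R * norm \<alpha>))"
  have "\<bar>of_int p * (x \<bullet> \<alpha>)\<bar> \<le> K \<alpha>" if "x \<in> ?X" for x \<alpha>
  proof -
    have "\<bar>x \<bullet> \<alpha>\<bar> \<le> norm x * norm \<alpha>" by (rule Cauchy_Schwarz_ineq2)
    also have "\<dots> \<le> R * norm \<alpha>" using that by (intro mult_right_mono) auto
    finally show ?thesis unfolding K_def abs_mult by (intro mult_left_mono) auto
  qed
  then have K: "- K \<alpha> \<le> of_int p * (x \<bullet> \<alpha>) \<and> of_int p * (x \<bullet> \<alpha>) \<le> K \<alpha>" if "x \<in> ?X" for x \<alpha>
    using that by (simp add: abs_le_iff) (metis minus_le_iff)
  have "f ` ?X \<subseteq> (\<Pi>\<^sub>E \<alpha>\<in>\<Phi>. {\<lfloor>- K \<alpha>\<rfloor>..\<lfloor>K \<alpha>\<rfloor>})"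
    unfolding f_def using K by (force intro: floor_mono)
  then have "finite (f ` ?X)" by (rule finite_subset) (intro finite_PiE finite_roots finite_atLeastAtMost_int)
  moreover have "inj_on f ?X"
  proof
    fix x y assume x: "x \<in> ?X" and y: "y \<in> ?X" and "f x = f y"
    have "(x - y) \<bullet> \<alpha> = 0" if "\<alpha> \<in> \<Phi>" for \<alpha>
    proof -
      have "\<lfloor>of_int p * (x \<bullet> \<alpha>)\<rfloor> = \<lfloor>of_int p * (y \<bullet> \<alpha>)\<rfloor>"
        using fun_cong[OF \<open>f x = f y\<close>, of \<alpha>] that by (simp add: f_def)
      moreover have "of_int p * (x \<bullet> \<alpha>) \<in> \<int>" "of_int p * (y \<bullet> \<alpha>) \<in> \<int>" using x y that by auto
      ultimately have "of_int p * (x \<bullet> \<alpha>) = of_int p * (y \<bullet> \<alpha>)"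
        by (metis Ints_cases floor_of_int)
      then show ?thesis using \<open>p \<noteq> 0\<close> by (simp add: inner_diff_left)
    qed
    then have "x - y = 0" by (rule orthogonal_to_spanning_set[OF span_roots])
    then show "x = y" by simp
  qed
  ultimately show ?thesis by (rule finite_imageD)
qed

text \<open>Borel--de Siebenthal: moving \<open>v\<close> into the fundamental alcove by the affine Weyl group, full
  rank forces it to be a vertex other than the origin. The representative of minimal norm modulo
  translations by coroots, made dominant, lies in that alcove.\<close>

lemma full_rank_coefficient:
  fixes p :: int
  assumes p: "Factorial_Ring.prime p"
    and v: "\<And>\<alpha>. \<alpha> \<in> \<Phi> \<Longrightarrow> of_int p * (v \<bullet> \<alpha>) \<in> \<int>"
      "span {\<alpha> \<in> \<Phi>. v \<bullet> \<alpha> \<in> \<int>} = UNIV" "\<exists>\<alpha>\<in>\<Phi>. v \<bullet> \<alpha> \<notin> \<int>"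
  shows "\<exists>a\<in>\<Delta>. cf \<theta> a = of_int p"
proof -
  have p0: "p > 0" using prime_gt_0_int[OF p] .
  define J where "J = (\<lambda>x. {\<alpha> \<in> \<Phi>. x \<bullet> \<alpha> \<in> \<int>})"
  \<comment> \<open>The properties of \<open>v\<close> that survive reflections and translations by
    coroots. Minimizing over all of \<open>C\<close> avoids forming an orbit of the affine Weyl
    group.\<close>
  define C where "C = {x. (\<forall>\<alpha>\<in>\<Phi>. of_int p * (x \<bullet> \<alpha>) \<in> \<int>) \<and> span (J x) = UNIV \<and> (\<exists>\<alpha>\<in>\<Phi>. x \<bullet> \<alpha> \<notin> \<int>)}"
  have vC: "v \<in> C" using v by (simp add: C_def J_def)
  have reflC: "root_reflection \<beta> x \<in> C" if x: "x \<in> C" and \<beta>: "\<beta> \<in> \<Phi>" for x \<beta>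
  proof -
    have "root_reflection \<beta> ` J x \<subseteq> J (root_reflection \<beta> x)"
      using reflection_root[OF _ \<beta>] by (auto simp: J_def root_reflection_isometry)
    then have "span (root_reflection \<beta> ` J x) \<subseteq> span (J (root_reflection \<beta> x))" by (rule span_mono)
    moreover have "span (root_reflection \<beta> ` J x) = range (root_reflection \<beta>)"
      using x by (simp add: C_def linear_span_image[OF linear_root_reflection])
    moreover have "range (root_reflection \<beta>) = UNIV"
      by (metis root_reflection_involution surjI)
    moreover obtain \<alpha> where "\<alpha> \<in> \<Phi>" "x \<bullet> \<alpha> \<notin> \<int>" using x by (auto simp: C_def)
    then have "\<exists>\<alpha>\<in>\<Phi>. root_reflection \<beta> x \<bullet> \<alpha> \<notin> \<int>"
      using reflection_root[OF _ \<beta>]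
      by (intro bexI[of _ "root_reflection \<beta> \<alpha>"]) (auto simp: root_reflection_isometry)
    moreover have "\<forall>\<alpha>\<in>\<Phi>. of_int p * (root_reflection \<beta> x \<bullet> \<alpha>) \<in> \<int>"
      using x reflection_root[OF _ \<beta>] by (simp add: C_def inner_root_reflection)
    ultimately show ?thesis by (auto simp: C_def)
  qed
  have translC: "x - coroot \<beta> \<in> C" if x: "x \<in> C" and \<beta>: "\<beta> \<in> \<Phi>" for x \<beta>
  proof -
    have int: "coroot \<beta> \<bullet> \<alpha> \<in> \<int>" if "\<alpha> \<in> \<Phi>" for \<alpha>
      using cartan_int[OF that \<beta>] by (simp add: inner_commute)
    have iff: "(x - coroot \<beta>) \<bullet> \<alpha> \<in> \<int> \<longleftrightarrow> x \<bullet> \<alpha> \<in> \<int>" if "\<alpha> \<in> \<Phi>" for \<alpha>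
    proof
      assume "(x - coroot \<beta>) \<bullet> \<alpha> \<in> \<int>"
      from Ints_add[OF this int[OF that]] show "x \<bullet> \<alpha> \<in> \<int>" by (simp add: inner_diff_left)
    next
      assume "x \<bullet> \<alpha> \<in> \<int>"
      from Ints_diff[OF this int[OF that]] show "(x - coroot \<beta>) \<bullet> \<alpha> \<in> \<int>"
        by (simp add: inner_diff_left)
    qed
    then have "J (x - coroot \<beta>) = J x" by (auto simp: J_def)
    moreover have "of_int p * ((x - coroot \<beta>) \<bullet> \<alpha>) \<in> \<int>" if "\<alpha> \<in> \<Phi>" for \<alpha>
      using Ints_diff[of "of_int p * (x \<bullet> \<alpha>)" "of_int p * (coroot \<beta> \<bullet> \<alpha>)"] x int[OF that] that
      by (simp add: C_def inner_diff_left right_diff_distrib)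
    moreover have "\<exists>\<alpha>\<in>\<Phi>. (x - coroot \<beta>) \<bullet> \<alpha> \<notin> \<int>" "span (J x) = UNIV"
      using x iff by (auto simp only: C_def mem_Collect_eq)
    ultimately show ?thesis unfolding C_def by simp
  qed
  obtain \<delta> :: 'a where \<delta>: "\<And>a. a \<in> \<Delta> \<Longrightarrow> \<delta> \<bullet> a = 1"
    using ex_vector_with_inner_on_independent[OF independent_base, of "\<lambda>_. 1"] by blast
  have finC: "finite {x \<in> C. norm x \<le> R}" for R
    by (rule finite_subset[OF _ bounded_coweights_finite[of p R]]) (use p0 in \<open>auto simp: C_def\<close>)
  obtain m where m: "m \<in> C" "\<And>y. y \<in> C \<Longrightarrow> norm m \<le> norm y"
  proof -
    have "{x \<in> C. norm x \<le> norm v} \<noteq> {}" using vC by blast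
    then obtain m where "m \<in> {x \<in> C. norm x \<le> norm v}"
      "\<forall>y\<in>{x \<in> C. norm x \<le> norm v}. - norm y \<le> - norm m"
      using ex_max_on[OF finC, of "norm v" "\<lambda>y. - norm y"] by blast
    then show ?thesis using that[of m] by force
  qed
  obtain x where x: "x \<in> C" "norm x = norm m"
    "\<And>y. y \<in> C \<Longrightarrow> norm y = norm m \<Longrightarrow> y \<bullet> \<delta> \<le> x \<bullet> \<delta>"
  proof -
    have "finite {x \<in> C. norm x = norm m}"
      by (rule finite_subset[OF _ finC[of "norm m"]]) auto
    moreover have "{x \<in> C. norm x = norm m} \<noteq> {}" using m(1) by blast
    ultimately obtain x where "x \<in> {x \<in> C. norm x = norm m}"
      "\<forall>y\<in>{x \<in> C. norm x = norm m}. y \<bullet> \<delta> \<le> x \<bullet> \<delta>"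
      using ex_max_on[of "{x \<in> C. norm x = norm m}" "\<lambda>y. y \<bullet> \<delta>"] by blast
    then show ?thesis using that[of x] by simp
  qed
  \<comment> \<open>Translating by the coroot of \<alpha> must not shorten \<open>x\<close>;
    expanding the squares gives exactly this bound.\<close>
  have alcove: "x \<bullet> \<alpha> \<le> 1" if \<alpha>: "\<alpha> \<in> \<Phi>" for \<alpha>
  proof -
    have "norm x \<le> norm (x - coroot \<alpha>)" using m(2)[OF translC[OF x(1) \<alpha>]] x(2) by simp
    then have "x \<bullet> x \<le> (x - coroot \<alpha>) \<bullet> (x - coroot \<alpha>)" by (simp add: norm_le)
    then have "2 * (x \<bullet> coroot \<alpha>) \<le> coroot \<alpha> \<bullet> coroot \<alpha>"
      by (simp add: inner_diff_left inner_diff_right inner_commute)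
    then have "4 * (x \<bullet> \<alpha>) / (\<alpha> \<bullet> \<alpha>) \<le> 4 / (\<alpha> \<bullet> \<alpha>)"
      unfolding coroot_inner_self inner_coroot[of x] by simp
    then show ?thesis using inner_self_pos[OF \<alpha>] by (simp add: divide_le_cancel)
  qed
  have dominant: "x \<bullet> a \<ge> 0" if a: "a \<in> \<Delta>" for a
  proof -
    have a': "a \<in> \<Phi>" using a base_subset by auto
    have "norm (root_reflection a x) = norm m"
      using root_reflection_isometry[of a x x] x(2) by (simp add: norm_eq)
    then have "root_reflection a x \<bullet> \<delta> \<le> x \<bullet> \<delta>" using x(3) reflC[OF x(1) a'] by blast
    then have "x \<bullet> coroot a \<ge> 0"
      using \<delta>[OF a] by (simp add: root_reflection_def inner_diff_left inner_commute[of a])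
    then show ?thesis using inner_self_pos[OF a'] by (simp add: inner_coroot zero_le_divide_iff)
  qed
  have Sx: "span (J x) = UNIV" and nonint: "\<exists>\<alpha>\<in>\<Phi>. x \<bullet> \<alpha> \<notin> \<int>"
    and px: "\<And>\<alpha>. \<alpha> \<in> \<Phi> \<Longrightarrow> of_int p * (x \<bullet> \<alpha>) \<in> \<int>"
    using x(1) by (auto simp: C_def)
  \<comment> \<open>As \<open>x\<close> is at most 1 on the highest root, equality on \<beta> forces
    every term of a sum of nonnegative numbers to vanish.\<close>
  have top: "cf \<beta> a = cf \<theta> a" if \<beta>: "\<beta> \<in> \<Phi>" "x \<bullet> \<beta> = 1" and a: "a \<in> \<Delta>" "x \<bullet> a \<noteq> 0" for \<beta> a
  proof -
    have nonneg: "(cf \<theta> b - cf \<beta> b) * (x \<bullet> b) \<ge> 0" if "b \<in> \<Delta>" for b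
      using dominant[OF that] highest_root_ge[OF \<beta>(1), of b] by simp
    have "(\<Sum>b\<in>\<Delta>. (cf \<theta> b - cf \<beta> b) * (x \<bullet> b)) = x \<bullet> \<theta> - x \<bullet> \<beta>"
      unfolding inner_expand[of x \<theta>] inner_expand[of x \<beta>] by (simp add: left_diff_distrib sum_subtractf)
    also have "\<dots> \<le> 0" using alcove[OF highest_root_in] \<beta>(2) by simp
    finally have "(\<Sum>b\<in>\<Delta>. (cf \<theta> b - cf \<beta> b) * (x \<bullet> b)) = 0"
      using sum_nonneg[of \<Delta> "\<lambda>b. (cf \<theta> b - cf \<beta> b) * (x \<bullet> b)"] nonneg by force
    then have "(cf \<theta> a - cf \<beta> a) * (x \<bullet> a) = 0"
      using sum_nonneg_eq_0_iff[OF finite_base, of "\<lambda>b. (cf \<theta> b - cf \<beta> b) * (x \<bullet> b)"] nonneg a(1) by blast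
    with a(2) show ?thesis by simp
  qed
  have zero: "cf \<beta> a = 0" if \<beta>: "pos_root \<beta>" "x \<bullet> \<beta> = 0" and a: "a \<in> \<Delta>" "x \<bullet> a \<noteq> 0" for \<beta> a
  proof -
    have nonneg: "cf \<beta> b * (x \<bullet> b) \<ge> 0" if "b \<in> \<Delta>" for b
      using dominant[OF that] \<beta>(1) by (simp add: pos_root_def)
    have "(\<Sum>b\<in>\<Delta>. cf \<beta> b * (x \<bullet> b)) = 0" using inner_expand[of x \<beta>] \<beta>(2) by simp
    then have "cf \<beta> a * (x \<bullet> a) = 0"
      using sum_nonneg_eq_0_iff[OF finite_base, of "\<lambda>b. cf \<beta> b * (x \<bullet> b)"] nonneg a(1) by blast
    with a(2) show ?thesis by simp
  qed
  \<comment> \<open>On \<open>J x\<close> the vector \<open>x\<close> takes only the values 1, -1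
    and 0, so on the simple roots where \<open>x\<close> is nonzero the coefficients of \<beta> are
    those of \<theta>, their negatives, or 0.\<close>
  have proportional: "cf \<theta> b * cf \<beta> a = cf \<theta> a * cf \<beta> b"
    if \<beta>: "\<beta> \<in> J x" and a: "a \<in> \<Delta>" "x \<bullet> a \<noteq> 0" and b: "b \<in> \<Delta>" "x \<bullet> b \<noteq> 0" for \<beta> a b
  proof -
    have \<beta>': "\<beta> \<in> \<Phi>" "- \<beta> \<in> \<Phi>" using \<beta> neg_root by (auto simp: J_def)
    obtain k where k: "x \<bullet> \<beta> = of_int k" using \<beta> by (auto simp: J_def elim: Ints_cases)
    have "x \<bullet> \<beta> \<le> 1" "- (x \<bullet> \<beta>) \<le> 1" using alcove[OF \<beta>'(1)] alcove[OF \<beta>'(2)] by simp_all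
    then have "k \<le> 1" "- k \<le> 1" unfolding k by simp_all
    then consider "k = 1" | "k = - 1" | "k = 0" by linarith
    then show ?thesis
    proof cases
      case 1
      then show ?thesis using top[OF \<beta>'(1) _ a] top[OF \<beta>'(1) _ b] k by simp
    next
      case 2
      then have "x \<bullet> - \<beta> = 1" using k by simp
      then have "cf \<theta> a = - cf \<beta> a" "cf \<theta> b = - cf \<beta> b"
        using top[OF \<beta>'(2) _ a] top[OF \<beta>'(2) _ b] by (simp_all add: cf_uminus)
      then show ?thesis by simp
    next
      case 3
      then have "x \<bullet> \<beta> = 0" "x \<bullet> - \<beta> = 0" using k by simp_all
      then show ?thesis
        using pos_or_neg_root[OF \<beta>'(1)] zero[of \<beta>] zero[of "- \<beta>"] a b by (auto simp: cf_uminus)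
    qed
  qed
  \<comment> \<open>The proportion is a linear condition, so full rank extends it to all vectors,
    and the simple root \<open>a\<close> itself violates it.\<close>
  have vertex: "a = b" if a: "a \<in> \<Delta>" "x \<bullet> a \<noteq> 0" and b: "b \<in> \<Delta>" "x \<bullet> b \<noteq> 0" for a b
  proof (rule ccontr)
    assume "a \<noteq> b"
    have "subspace {y. cf \<theta> b * cf y a = cf \<theta> a * cf y b}"
      by (rule subspaceI) (auto simp: cf_add cf_scaleR distrib_left algebra_simps representation_zero)
    then have "span (J x) \<subseteq> {y. cf \<theta> b * cf y a = cf \<theta> a * cf y b}"
      using proportional[OF _ a b] by (intro span_minimal) auto
    then have "cf \<theta> b * cf a a = cf \<theta> a * cf a b" using Sx by auto
    then have "cf \<theta> b = 0" using a(1) \<open>a \<noteq> b\<close> by (simp add: cf_simple)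
    with cf_highest_root_ge_1[OF b(1)] show False by simp
  qed
  have "x \<noteq> 0" using nonint by auto
  then obtain \<beta>0 where \<beta>0: "\<beta>0 \<in> J x" "x \<bullet> \<beta>0 \<noteq> 0"
    using orthogonal_to_spanning_set[OF Sx, of x] by blast
  obtain \<beta> where \<beta>: "\<beta> \<in> \<Phi>" "x \<bullet> \<beta> \<in> \<int>" "x \<bullet> \<beta> > 0"
  proof (cases "x \<bullet> \<beta>0 > 0")
    case True
    then show ?thesis using that[of \<beta>0] \<beta>0 by (auto simp: J_def)
  next
    case False
    then show ?thesis using that[of "- \<beta>0"] \<beta>0 neg_root by (auto simp: J_def)
  qed
  then have \<beta>1: "x \<bullet> \<beta> = 1" using alcove[OF \<beta>(1)] by (auto elim!: Ints_cases)
  obtain a where a: "a \<in> \<Delta>" "x \<bullet> a \<noteq> 0"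
    using orthogonal_to_spanning_set[OF span_base_eq, of x] \<open>x \<noteq> 0\<close> by blast
  have "x \<bullet> \<beta> = (\<Sum>b\<in>\<Delta>. if b = a then cf \<beta> a * (x \<bullet> a) else 0)"
    unfolding inner_expand[of x \<beta>] using vertex[OF _ _ a] by (intro sum.cong) auto
  \<comment> \<open>With one nonzero coordinate left, \<open>x\<close> is the vertex opposite to
    \<open>a\<close>, with value 1/h on \<open>a\<close>; hence h divides \<open>p\<close>, and h =
    1 would make \<open>x\<close> integral on all roots.\<close>
  then have prod: "cf \<theta> a * (x \<bullet> a) = 1"
    using \<beta>1 top[OF \<beta>(1) \<beta>1 a] a(1) finite_base by simp
  obtain h where h: "cf \<theta> a = of_int h" using cf_int[OF highest_root_in, of a] by (elim Ints_cases)
  obtain k where k: "of_int p * (x \<bullet> a) = of_int k"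
    using px[of a] a(1) base_subset by (auto elim: Ints_cases)
  have "real_of_int p = of_int p * (cf \<theta> a * (x \<bullet> a))" by (simp add: prod)
  also have "\<dots> = of_int (h * k)" using k by (simp add: h mult_ac)
  finally have hk: "p = h * k" by (simp only: of_int_eq_iff)
  have "h \<ge> 1" using cf_highest_root_ge_1[OF a(1)] unfolding h by simp
  have "h \<noteq> 1"
  proof
    assume "h = 1"
    then have "x \<bullet> a = 1" using prod h by simp
    then have simple: "x \<bullet> b \<in> \<int>" if "b \<in> \<Delta>" for b
      using vertex[OF that _ a] by (cases "x \<bullet> b = 0") auto
    have "x \<bullet> \<alpha> \<in> \<int>" if "\<alpha> \<in> \<Phi>" for \<alpha>
      using inner_roots_int[OF that, of 1 x] simple by simp
    with nonint show False by blast
  qed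
  moreover have "h = 1 \<or> h = p"
    using p hk \<open>h \<ge> 1\<close> by (metis dvd_triv_left prime_int_iff order_trans zero_le_one)
  ultimately have "cf \<theta> a = of_int p" by (simp add: h)
  with a(1) show ?thesis by blast
qed

text \<open>Squared lengths in the lattice generated by the roots as long as \<alpha> are multiples
  of \<open>p\<close> times that of \<sigma>. So a multiplier \<open>N\<close> sending \<sigma> into
  it has \<open>N * N\<close> divisible by \<open>p\<close>, and a vector of order \<open>p\<close>
  integral on these roots exists. They span, which gives full rank.\<close>

lemma length_ratio_coefficient:
  assumes p: "Factorial_Ring.prime p" and \<sigma>: "\<sigma> \<in> \<Phi>" and "\<alpha> \<in> \<Phi>" "\<alpha> \<bullet> \<alpha> = of_int p * (\<sigma> \<bullet> \<sigma>)"
  shows "\<exists>a\<in>\<Delta>. cf \<theta> a = of_int p"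
proof -
  define A where "A = {\<beta> \<in> \<Phi>. \<beta> \<bullet> \<beta> = \<alpha> \<bullet> \<alpha>}"
  have spanA: "span A = UNIV" unfolding A_def by (rule span_roots_of_length[OF assms(3)])
  have negA: "- x \<in> A" if "x \<in> A" for x using that neg_root by (auto simp: A_def)
  have pos: "\<sigma> \<bullet> \<sigma> > 0" using inner_self_pos[OF \<sigma>] .
  have "False" if N: "coprime N p" "\<forall>b\<in>\<Delta>. of_int N *\<^sub>R b \<in> sums_of A" for N
  proof -
    \<comment> \<open>The pairings with \<open>A\<close> are carried along because the square of a
      sum contributes the cross term 2(a \<bullet> y).\<close>
    have sums: "(\<forall>a\<in>A. \<exists>m::int. 2 * (a \<bullet> x) = of_int m * (\<alpha> \<bullet> \<alpha>)) \<and> (\<exists>m::int. x \<bullet> x = of_int m * (\<alpha> \<bullet> \<alpha>))"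
      if "x \<in> sums_of A" for x
      using that
    proof (induction rule: sums_of_induct)
      case zero
      show ?case by (auto intro!: exI[of _ 0])
    next
      case (add a y)
      have AA: "\<exists>m::int. 2 * (a' \<bullet> a) = of_int m * (\<alpha> \<bullet> \<alpha>)" if a': "a' \<in> A" for a'
      proof -
        obtain m where "a' \<bullet> coroot a = of_int m"
          using cartan_int[of a' a] a' add(1) by (auto simp: A_def elim: Ints_cases)
        then show ?thesis
          using add(1) inner_self_pos[OF assms(3)] by (intro exI[of _ m]) (auto simp: A_def inner_coroot field_simps)
      qed
      have "\<exists>m::int. 2 * (a' \<bullet> (a + y)) = of_int m * (\<alpha> \<bullet> \<alpha>)" if a': "a' \<in> A" for a'
      proof -
        obtain m m' :: int where "2 * (a' \<bullet> a) = of_int m * (\<alpha> \<bullet> \<alpha>)" "2 * (a' \<bullet> y) = of_int m' * (\<alpha> \<bullet> \<alpha>)"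
          using AA[OF a'] add(3) a' by blast
        then show ?thesis by (intro exI[of _ "m + m'"]) (simp add: inner_add_right algebra_simps)
      qed
      moreover have "\<exists>m::int. (a + y) \<bullet> (a + y) = of_int m * (\<alpha> \<bullet> \<alpha>)"
      proof -
        obtain m m' :: int where "2 * (a \<bullet> y) = of_int m * (\<alpha> \<bullet> \<alpha>)" "y \<bullet> y = of_int m' * (\<alpha> \<bullet> \<alpha>)"
          using add(1,3) by blast
        moreover have "a \<bullet> a = \<alpha> \<bullet> \<alpha>" using add(1) by (simp add: A_def)
        moreover have "(a + y) \<bullet> (a + y) = a \<bullet> a + 2 * (a \<bullet> y) + y \<bullet> y"
          by (simp add: inner_add_left inner_add_right inner_commute)
        ultimately show ?thesis by (intro exI[of _ "1 + m + m'"]) (simp add: algebra_simps)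
      qed
      ultimately show ?case by blast
    qed
    have "of_int N *\<^sub>R \<sigma> = (\<Sum>b\<in>\<Delta>. cf \<sigma> b *\<^sub>R (of_int N *\<^sub>R b))"
      by (subst expand[of \<sigma>]) (simp add: scaleR_sum_right mult.commute)
    also have "\<dots> \<in> sums_of A"
    proof (rule sums_of_sum)
      fix b assume "b \<in> \<Delta>"
      obtain c where "cf \<sigma> b = of_int c" using cf_int[OF \<sigma>, of b] by (elim Ints_cases)
      then show "cf \<sigma> b *\<^sub>R (of_int N *\<^sub>R b) \<in> sums_of A"
        using sums_of_scaleR_int[of "of_int N *\<^sub>R b" A c] N(2) \<open>b \<in> \<Delta>\<close> negA by simp
    qed
    finally obtain m where "(of_int N *\<^sub>R \<sigma>) \<bullet> (of_int N *\<^sub>R \<sigma>) = of_int m * (\<alpha> \<bullet> \<alpha>)"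
      using sums by blast
    then have "of_int (N * N) * (\<sigma> \<bullet> \<sigma>) = of_int (m * p) * (\<sigma> \<bullet> \<sigma>)"
      unfolding assms(4) by (simp add: mult_ac)
    then have "real_of_int (N * N) = of_int (m * p)" using pos by (simp only: mult_cancel_right) simp
    then have "N * N = m * p" by (simp only: of_int_eq_iff)
    then have "p dvd N * N" by simp
    then have "p dvd N" using p prime_dvd_mult_iff by blast
    with N(1) p show False by (metis coprime_absorb_right not_prime_unit)
  qed
  then obtain v where v: "\<forall>b\<in>\<Delta>. of_int p * (v \<bullet> b) \<in> \<int>" "\<exists>b\<in>\<Delta>. v \<bullet> b \<notin> \<int>" "\<forall>x\<in>A. v \<bullet> x \<in> \<int>"
    using lattice_mod_prime[OF independent_base finite_base span_base_eq p, of A] cf_int negA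
    by (auto simp: A_def)
  show ?thesis
  proof (rule full_rank_coefficient[OF p])
    show "of_int p * (v \<bullet> \<alpha>) \<in> \<int>" if "\<alpha> \<in> \<Phi>" for \<alpha> using inner_roots_int[OF that] v(1) by blast
    have "span A \<subseteq> span {\<alpha> \<in> \<Phi>. v \<bullet> \<alpha> \<in> \<int>}" using v(3) by (intro span_mono) (auto simp: A_def)
    then show "span {\<alpha> \<in> \<Phi>. v \<bullet> \<alpha> \<in> \<int>} = UNIV" using spanA by auto
    show "\<exists>\<alpha>\<in>\<Phi>. v \<bullet> \<alpha> \<notin> \<int>" using v(2) base_subset by blast
  qed
qed

text \<open>If \<open>p\<close> is prime to all squared length ratios, integrality on roots and on coroots agree
  after rescaling; otherwise \<open>p\<close> is itself such a ratio.\<close>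

lemma full_rank_coefficient_dual:
  fixes p :: int
  assumes p: "Factorial_Ring.prime p"
    and v: "\<And>\<alpha>. \<alpha> \<in> \<Phi> \<Longrightarrow> of_int p * (v \<bullet> coroot \<alpha>) \<in> \<int>"
      "span (integral_roots \<Phi> v) = UNIV" "integral_roots \<Phi> v \<noteq> \<Phi>"
  shows "\<exists>a\<in>\<Delta>. cf \<theta> a = of_int p"
proof -
  obtain \<sigma> where \<sigma>: "\<sigma> \<in> \<Phi>" "\<And>\<gamma>. \<gamma> \<in> \<Phi> \<Longrightarrow> \<sigma> \<bullet> \<sigma> \<le> \<gamma> \<bullet> \<gamma>" using ex_shortest by blast
  show ?thesis
  proof (cases "\<exists>\<alpha>\<in>\<Phi>. \<alpha> \<bullet> \<alpha> = of_int p * (\<sigma> \<bullet> \<sigma>)")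
    case True
    then show ?thesis using length_ratio_coefficient[OF p \<sigma>(1)] by blast
  next
    case False
    \<comment> \<open>With this scale \<open>w\<close> pairs with \<alpha> as \<open>r\<close> times
      \<open>v\<close> does with \<open>coroot\<close> \<alpha>, where \<open>r\<close> is the
      squared length ratio to the shortest root.\<close>
    define w where "w = (2 / (\<sigma> \<bullet> \<sigma>)) *\<^sub>R v"
    have w: "of_int p * (w \<bullet> \<alpha>) \<in> \<int> \<and> (w \<bullet> \<alpha> \<in> \<int> \<longleftrightarrow> v \<bullet> coroot \<alpha> \<in> \<int>)" if \<alpha>: "\<alpha> \<in> \<Phi>" for \<alpha>
    proof -
      obtain r :: nat where r: "r \<in> {1, 2, 3}" "\<alpha> \<bullet> \<alpha> = real r * (\<sigma> \<bullet> \<sigma>)"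
        using length_ratio_ordered[OF \<sigma>(1) \<alpha> \<sigma>(2)[OF \<alpha>]] by blast
      have wr: "w \<bullet> \<alpha> = real r * (v \<bullet> coroot \<alpha>)"
        using inner_self_pos[OF \<sigma>(1)] r by (auto simp: w_def inner_coroot r(2))
      obtain m where m: "of_int p * (v \<bullet> coroot \<alpha>) = of_int m" using v(1)[OF \<alpha>] by (elim Ints_cases)
      have "of_int p * (w \<bullet> \<alpha>) = of_int (int r * m)"
        unfolding wr using m by simp
      then have "of_int p * (w \<bullet> \<alpha>) \<in> \<int>" by (metis Ints_of_int)
      moreover have "v \<bullet> coroot \<alpha> \<in> \<int>" if w_int: "w \<bullet> \<alpha> \<in> \<int>"
      proof -
        obtain n where n: "real r * (v \<bullet> coroot \<alpha>) = of_int n" using w_int unfolding wr by (elim Ints_cases)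
        have "int r \<noteq> p" using False \<alpha> r(2) by auto
        moreover have "int r = 1 \<or> Factorial_Ring.prime (int r)" using r(1) by auto
        ultimately have "coprime (int r) p" using p primes_coprime[of "int r" p] by auto
        \<comment> \<open>Both \<open>r\<close> and \<open>p\<close> times the pairing are integers,
          so Bezout recovers integrality of the pairing itself.\<close>
        then obtain x y where xy: "x * int r + y * p = 1" using bezout_int[of "int r" p] by auto
        have "v \<bullet> coroot \<alpha> = of_int (x * int r + y * p) * (v \<bullet> coroot \<alpha>)" unfolding xy by simp
        also have "\<dots> = of_int x * (real r * (v \<bullet> coroot \<alpha>)) + of_int y * (of_int p * (v \<bullet> coroot \<alpha>))"
          by (simp add: algebra_simps)
        also have "\<dots> \<in> \<int>" unfolding n m by simp
        finally show ?thesis .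
      qed
      moreover have "w \<bullet> \<alpha> \<in> \<int>" if "v \<bullet> coroot \<alpha> \<in> \<int>" using that unfolding wr by simp
      ultimately show ?thesis by blast
    qed
    then have "{\<alpha> \<in> \<Phi>. w \<bullet> \<alpha> \<in> \<int>} = integral_roots \<Phi> v" by (auto simp: integral_roots_def)
    then show ?thesis using full_rank_coefficient[OF p, of w] w v by auto
  qed
qed

end

section \<open>Characters of the Cartan part\<close>

lemma is_subfield_complex_adjoin: "is_subfield (complex_adjoin t)"
  unfolding complex_adjoin_def by (rule hull_in) (auto simp: is_subfield_def)

lemma complex_adjoin_generator: "t \<in> complex_adjoin t"
  and complex_adjoin_const: "qconst c \<in> complex_adjoin t"
  unfolding complex_adjoin_def by (auto intro: hull_inc)

lemma subfield_closed:
  assumes "is_subfield K"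
  shows "0 \<in> K" "1 \<in> K" "x \<in> K \<Longrightarrow> y \<in> K \<Longrightarrow> x + y \<in> K" "x \<in> K \<Longrightarrow> y \<in> K \<Longrightarrow> x * y \<in> K"
    "x \<in> K \<Longrightarrow> inverse x \<in> K"
  using assms unfolding is_subfield_def by auto

lemma subfield_power: "is_subfield K \<Longrightarrow> x \<in> K \<Longrightarrow> x ^ n \<in> K"
  by (induction n) (auto intro: subfield_closed)

lemma subfield_power_int: "is_subfield K \<Longrightarrow> x \<in> K \<Longrightarrow> x powi n \<in> K"
  by (auto simp: power_int_def intro: subfield_closed subfield_power)

lemma subfield_sum: "is_subfield K \<Longrightarrow> (\<And>i. i \<in> I \<Longrightarrow> f i \<in> K) \<Longrightarrow> sum f I \<in> K"
  by (induction I rule: infinite_finite_induct) (auto intro: subfield_closed)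

section \<open>Complex constants and powers of q\<close>

lemma qconst_mult: "qconst (c * d) = qconst c * qconst d"
  by (simp add: qconst_def mult.commute flip: to_ac_mult)

lemma qconst_1: "qconst 1 = 1"
  by (simp add: qconst_def One_fract_def[symmetric] flip: one_pCons)

lemma qconst_eq_1_iff: "qconst c = 1 \<longleftrightarrow> c = 1"
  by (auto simp: qconst_1) (simp add: qconst_def One_fract_def eq_fract one_pCons)

lemma qvar_power: "qvar ^ n = to_ac (Fract (Polynomial.monom 1 n) 1)"
proof -
  have "Fract [:0, 1:] 1 ^ n = Fract (Polynomial.monom (1::complex) n) 1"
    by (induction n) (simp_all add: One_fract_def monom_Suc)
  then show ?thesis by (simp add: qvar_def flip: to_ac_power)
qed

lemma qvar_nonzero: "qvar \<noteq> 0"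
  by (simp add: qvar_def Zero_fract_def eq_fract)

lemma qconst_mult_qvar_power_eq_1:
  assumes "qconst c * qvar ^ n = 1"
  shows "n = 0"
proof -
  have "to_ac (Fract ([:c:] * Polynomial.monom 1 n) 1) = to_ac 1"
    using assms unfolding qvar_power qconst_def by (simp flip: to_ac_mult)
  then have "Fract ([:c:] * Polynomial.monom 1 n) 1 = Fract 1 1"
    by (simp only: to_ac_eq_iff One_fract_def)
  then have "Polynomial.smult c (Polynomial.monom 1 n) = 1" by (simp add: eq_fract)
  then have eq: "Polynomial.monom c n = 1" by (simp add: smult_monom)
  have "Polynomial.coeff (Polynomial.monom c n) 0 = 1" by (simp only: eq) simp
  then show ?thesis by (simp split: if_splits)
qed

text \<open>The transcendence of q in the form needed: after moving everything to a nonnegative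
  exponent, compare constant coefficients of polynomials.\<close>

lemma qconst_eq_qvar_power_int:
  assumes "qconst c = qvar powi k" "c \<noteq> 0"
  shows "k = 0"
proof (cases "k \<ge> 0")
  case True
  then have "qconst (1 / c) * qvar ^ nat k = qconst (1 / c) * qconst c"
    using assms(1) by (simp add: power_int_def)
  also have "\<dots> = 1" using assms(2) by (simp add: qconst_1 flip: qconst_mult)
  finally show ?thesis using qconst_mult_qvar_power_eq_1[of "1 / c" "nat k"] True by simp
next
  case False
  then have "qconst c * qvar ^ nat (- k) = 1"
    using assms(1) qvar_nonzero by (simp add: power_int_def flip: power_mult_distrib)
  with qconst_mult_qvar_power_eq_1 have "nat (- k) = 0" by blast
  with False show ?thesis by simp
qed

text \<open>Raising to the power \<open>n\<close> reduces the claim to powers of q.\<close>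

lemma root_of_qvar_power_int_eq:
  assumes t: "t ^ n = qvar" and eq: "t powi a = t powi b"
  shows "a = b"
proof -
  have "t \<noteq> 0"
  proof
    assume "t = 0"
    with t have "qvar = 0 ^ n" by simp
    then have "n = 0" using qvar_nonzero by (cases n) auto
    then have "qvar ^ 1 = qconst 1" using t by (simp add: qconst_1)
    then show False using qconst_eq_qvar_power_int[of 1 1] by simp
  qed
  have "qvar powi k = (t powi k) ^ n" for k
    by (simp add: t[symmetric] power_int_power power_int_power' mult.commute)
  then have "qvar powi a = qvar powi b" using eq by simp
  then have "qvar powi (a - b) = 1" using qvar_nonzero by (simp add: power_int_diff)
  then show ?thesis using qconst_eq_qvar_power_int[of 1 "a - b"] by (simp add: qconst_1)
qed

section \<open>Algebra homomorphisms from multiplicative functions on the root lattice\<close>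

definition linear_extension :: "('a \<Rightarrow> 'b::comm_semiring_1) \<Rightarrow> ('a \<Rightarrow>\<^sub>0 'b) \<Rightarrow> 'b" where
  "linear_extension \<xi> x = (\<Sum>\<mu>\<in>Poly_Mapping.keys x. Poly_Mapping.lookup x \<mu> * \<xi> \<mu>)"

lemma linear_extension_superset:
  assumes "finite S" "Poly_Mapping.keys x \<subseteq> S"
  shows "linear_extension \<xi> x = (\<Sum>\<mu>\<in>S. Poly_Mapping.lookup x \<mu> * \<xi> \<mu>)"
  unfolding linear_extension_def
  by (rule sum.mono_neutral_left) (use assms in \<open>auto simp: in_keys_iff\<close>)

lemma linear_extension_add:
  "linear_extension \<xi> (x + y) = linear_extension \<xi> x + linear_extension \<xi> y"
proof -
  let ?S = "Poly_Mapping.keys x \<union> Poly_Mapping.keys y"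
  have "Poly_Mapping.keys (x + y) \<subseteq> ?S" by (rule keys_add)
  then show ?thesis
    by (simp add: linear_extension_superset[of ?S] lookup_add distrib_right sum.distrib)
qed

lemma linear_extension_sum:
  "linear_extension \<xi> (sum f I) = (\<Sum>i\<in>I. linear_extension \<xi> (f i))"
  by (induction I rule: infinite_finite_induct)
    (simp_all add: linear_extension_add, simp_all add: linear_extension_def)

lemma linear_extension_single: "linear_extension \<xi> (Poly_Mapping.single \<mu> c) = c * \<xi> \<mu>"
  by (cases "c = 0") (simp_all add: linear_extension_def)

lemma poly_mapping_eq_sum_single:
  "x = (\<Sum>\<mu>\<in>Poly_Mapping.keys x. Poly_Mapping.single \<mu> (Poly_Mapping.lookup x \<mu>))"
proof (rule poly_mapping_eqI)
  fix k
  have "(\<Sum>\<mu>\<in>Poly_Mapping.keys x. Poly_Mapping.lookup (Poly_Mapping.single \<mu> (Poly_Mapping.lookup x \<mu>)) k) =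
      (\<Sum>\<mu>\<in>Poly_Mapping.keys x. if \<mu> = k then Poly_Mapping.lookup x k else 0)"
    by (intro sum.cong) (auto simp: lookup_single)
  then show "Poly_Mapping.lookup x k = Poly_Mapping.lookup
      (\<Sum>\<mu>\<in>Poly_Mapping.keys x. Poly_Mapping.single \<mu> (Poly_Mapping.lookup x \<mu>)) k"
    by (auto simp: lookup_sum in_keys_iff)
qed

text \<open>Multiplicativity is asked only on the supports, because exponents defined by a floor
  will be additive only on the root lattice.\<close>

lemma linear_extension_mult:
  assumes "\<And>\<mu> \<nu>. \<mu> \<in> Poly_Mapping.keys x \<Longrightarrow> \<nu> \<in> Poly_Mapping.keys y \<Longrightarrow> \<xi> (\<mu> + \<nu>) = \<xi> \<mu> * \<xi> \<nu>"
  shows "linear_extension \<xi> (x * y) = linear_extension \<xi> x * linear_extension \<xi> y"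
proof -
  let ?s = "\<lambda>x \<mu>. Poly_Mapping.single \<mu> (Poly_Mapping.lookup x \<mu>)"
  have "x * y = (\<Sum>\<mu>\<in>Poly_Mapping.keys x. ?s x \<mu>) * (\<Sum>\<nu>\<in>Poly_Mapping.keys y. ?s y \<nu>)"
    using poly_mapping_eq_sum_single[of x] poly_mapping_eq_sum_single[of y] by metis
  also have "linear_extension \<xi> \<dots> = (\<Sum>\<mu>\<in>Poly_Mapping.keys x. \<Sum>\<nu>\<in>Poly_Mapping.keys y.
      (Poly_Mapping.lookup x \<mu> * \<xi> \<mu>) * (Poly_Mapping.lookup y \<nu> * \<xi> \<nu>))"
    unfolding sum_product linear_extension_sum mult_single linear_extension_single
    by (intro sum.cong) (auto simp: assms mult_ac)
  also have "\<dots> = linear_extension \<xi> x * linear_extension \<xi> y"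
    unfolding linear_extension_def sum_product ..
  finally show ?thesis .
qed

lemma linear_extension_torus_character:
  assumes F: "is_subfield F"
    and \<xi>: "\<And>\<mu>. \<mu> \<in> root_lattice \<Phi> \<Longrightarrow> \<xi> \<mu> \<in> F"
      "\<And>\<mu> \<nu>. \<mu> \<in> root_lattice \<Phi> \<Longrightarrow> \<nu> \<in> root_lattice \<Phi> \<Longrightarrow> \<xi> (\<mu> + \<nu>) = \<xi> \<mu> * \<xi> \<nu>"
      "\<xi> 0 = 1"
  shows "linear_extension \<xi> \<in> torus_characters \<Phi> F"
proof -
  have "0 \<in> root_lattice \<Phi>"
    unfolding root_lattice_def by (auto intro: exI[of _ "\<lambda>_. 0"])
  then have "Poly_Mapping.keys (Poly_Mapping.single 0 c) \<subseteq> root_lattice \<Phi>" for c :: qclosure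
    by simp
  moreover have "linear_extension \<xi> x \<in> F" if "x \<in> cartan_algebra \<Phi> F" for x
    unfolding linear_extension_def
    using that \<xi>(1) by (intro subfield_sum[OF F] subfield_closed(4)[OF F]) (auto simp: cartan_algebra_def)
  moreover have "linear_extension \<xi> (x * y) = linear_extension \<xi> x * linear_extension \<xi> y"
    if "Poly_Mapping.keys x \<subseteq> root_lattice \<Phi>" "Poly_Mapping.keys y \<subseteq> root_lattice \<Phi>" for x y
    using that \<xi>(2) by (intro linear_extension_mult) auto
  ultimately show ?thesis
    unfolding torus_characters_def
    by (auto simp: linear_extension_add linear_extension_single \<xi>(3) cartan_algebra_def
        simp flip: single_one)
qed

lemma quantum_integral_roots_linear_extension:
  "quantum_integral_roots \<Phi> (linear_extension \<xi>) =
    {\<alpha> \<in> \<Phi>. \<exists>k m :: int. \<xi> (2 *\<^sub>R \<alpha>) = qvar powi k \<and> real_of_int k = real_of_int m * (\<alpha> \<bullet> \<alpha>)}"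
  unfolding quantum_integral_roots_def Kelt_def linear_extension_single by auto

text \<open>All values on the \<open>Kelt\<close> basis are nonzero constants, and such a constant
  is a power of q only if it is 1.\<close>

lemma quantum_integral_roots_torsion:
  assumes F: "\<And>c. qconst c \<in> F" "is_subfield F"
  shows "\<exists>\<Lambda>\<in>torus_characters \<Phi> F. quantum_integral_roots \<Phi> \<Lambda> = {\<alpha> \<in> \<Phi>. v \<bullet> \<alpha> \<in> \<int>}"
proof -
  \<comment> \<open>Half of the usual 2 pi, since integrality is tested on 2\<alpha>.\<close>
  define \<xi> where "\<xi> = (\<lambda>\<mu>. qconst (cis (pi * (v \<bullet> \<mu>))))"
  have "linear_extension \<xi> \<in> torus_characters \<Phi> F"
    by (rule linear_extension_torus_character[OF F(2)])
      (auto simp: \<xi>_def F(1) qconst_1 inner_add_right distrib_left simp flip: qconst_mult cis_mult)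
  moreover have "(\<exists>k m :: int. \<xi> (2 *\<^sub>R \<alpha>) = qvar powi k \<and> real_of_int k = real_of_int m * (\<alpha> \<bullet> \<alpha>)) \<longleftrightarrow>
      v \<bullet> \<alpha> \<in> \<int>" for \<alpha>
  proof -
    have "\<xi> (2 *\<^sub>R \<alpha>) = 1 \<longleftrightarrow> v \<bullet> \<alpha> \<in> \<int>"
      unfolding \<xi>_def qconst_eq_1_iff
      by (auto simp: cis_eq_1_iff Ints_def mult_ac)
    moreover have "k = 0" if "\<xi> (2 *\<^sub>R \<alpha>) = qvar powi k" for k
      using that qconst_eq_qvar_power_int[of _ k] cis_neq_zero unfolding \<xi>_def by blast
    ultimately show ?thesis by (metis mult_zero_left of_int_0 power_int_0_right)
  qed
  ultimately show ?thesis
    by (intro bexI[of _ "linear_extension \<xi>"]) (auto simp: quantum_integral_roots_linear_extension)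
qed

text \<open>The character is q^(v,\<mu>), written with the root \<open>t\<close> of q. On 2\<alpha>
  its exponent is (v,\<alpha>^vee)(\<alpha>,\<alpha>), which is an integral multiple of
  (\<alpha>,\<alpha>) exactly when \<open>v\<close> is integral on the coroot.\<close>

lemma quantum_integral_roots_weight:
  assumes t: "t ^ n = qvar" and F: "t \<in> F" "is_subfield F"
    and int: "\<And>\<alpha>. \<alpha> \<in> \<Phi> \<Longrightarrow> real n * (v \<bullet> \<alpha>) \<in> \<int>"
    and nonzero: "0 \<notin> \<Phi>" and norm: "\<And>\<alpha>. \<alpha> \<in> \<Phi> \<Longrightarrow> \<alpha> \<bullet> \<alpha> \<in> \<int>"
  shows "\<exists>\<Lambda>\<in>torus_characters \<Phi> F. quantum_integral_roots \<Phi> \<Lambda> = integral_roots \<Phi> v"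
proof -
  \<comment> \<open>The floor only makes the exponent total; on the root lattice its argument is an
    integer.\<close>
  define e where "e = (\<lambda>\<mu>. \<lfloor>real n * (v \<bullet> \<mu>)\<rfloor>)"
  define \<xi> where "\<xi> = (\<lambda>\<mu>. t powi e \<mu>)"
  have e: "of_int (e \<mu>) = real n * (v \<bullet> \<mu>)" if "\<mu> \<in> root_lattice \<Phi>" for \<mu>
  proof -
    obtain c where "\<mu> = (\<Sum>\<alpha>\<in>\<Phi>. of_int (c \<alpha>) *\<^sub>R \<alpha>)"
      using \<open>\<mu> \<in> root_lattice \<Phi>\<close> unfolding root_lattice_def by blast
    then have "real n * (v \<bullet> \<mu>) = (\<Sum>\<alpha>\<in>\<Phi>. of_int (c \<alpha>) * (real n * (v \<bullet> \<alpha>)))"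
      by (simp add: inner_sum_right sum_distrib_left mult_ac)
    moreover have "(\<Sum>\<alpha>\<in>\<Phi>. of_int (c \<alpha>) * (real n * (v \<bullet> \<alpha>))) \<in> \<int>"
      by (rule Ints_sum) (rule Ints_mult[OF Ints_of_int int])
    ultimately have "real n * (v \<bullet> \<mu>) \<in> \<int>" by simp
    then show ?thesis by (auto simp: e_def elim: Ints_cases)
  qed
  have "n \<noteq> 0"
  proof
    assume "n = 0"
    then have "qconst 1 = qvar powi 1" using t by (simp add: qconst_1)
    then show False using qconst_eq_qvar_power_int[of 1 1] by simp
  qed
  have "t \<noteq> 0" using t \<open>n \<noteq> 0\<close> qvar_nonzero by (metis power_0_left)
  have e_add: "e (\<mu> + \<nu>) = e \<mu> + e \<nu>" if "\<mu> \<in> root_lattice \<Phi>" "\<nu> \<in> root_lattice \<Phi>" for \<mu> \<nu>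
  proof -
    have "real n * (v \<bullet> (\<mu> + \<nu>)) = of_int (e \<mu> + e \<nu>)"
      using e[OF that(1)] e[OF that(2)] by (simp add: inner_add_right distrib_left)
    then show ?thesis unfolding e_def[of] by (simp only: floor_of_int)
  qed
  have "linear_extension \<xi> \<in> torus_characters \<Phi> F"
  proof (rule linear_extension_torus_character[OF F(2)])
    show "\<xi> \<mu> \<in> F" for \<mu> unfolding \<xi>_def by (rule subfield_power_int[OF F(2,1)])
    show "\<xi> 0 = 1" by (simp add: \<xi>_def e_def)
    show "\<xi> (\<mu> + \<nu>) = \<xi> \<mu> * \<xi> \<nu>" if "\<mu> \<in> root_lattice \<Phi>" "\<nu> \<in> root_lattice \<Phi>" for \<mu> \<nu>
      using \<open>t \<noteq> 0\<close> by (simp add: \<xi>_def e_add[OF that] power_int_add)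
  qed
  moreover have "(\<exists>k m :: int. \<xi> (2 *\<^sub>R \<alpha>) = qvar powi k \<and> real_of_int k = real_of_int m * (\<alpha> \<bullet> \<alpha>)) \<longleftrightarrow>
      v \<bullet> coroot \<alpha> \<in> \<int>" if \<alpha>: "\<alpha> \<in> \<Phi>" for \<alpha>
  proof -
    have pos: "\<alpha> \<bullet> \<alpha> > 0" using \<alpha> nonzero by auto
    obtain j where j: "real n * (v \<bullet> \<alpha>) = of_int j" using int[OF \<alpha>] by (elim Ints_cases)
    have e2: "e (2 *\<^sub>R \<alpha>) = 2 * j"
    proof -
      have "real n * (v \<bullet> 2 *\<^sub>R \<alpha>) = of_int (2 * j)" using j by simp
      then show ?thesis unfolding e_def by (simp only: floor_of_int)
    qed
    have "\<xi> (2 *\<^sub>R \<alpha>) = qvar powi k \<longleftrightarrow> 2 * j = int n * k" for k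
    proof -
      have "qvar powi k = t powi (int n * k)"
        unfolding t[symmetric] by (simp add: power_int_mult)
      then show ?thesis unfolding \<xi>_def e2 using root_of_qvar_power_int_eq[OF t] by auto
    qed
    moreover have "2 * j = int n * k \<longleftrightarrow> of_int k = (v \<bullet> coroot \<alpha>) * (\<alpha> \<bullet> \<alpha>)" for k
    proof -
      have "2 * j = int n * k \<longleftrightarrow> real_of_int (2 * j) = of_int (int n * k)"
        by (simp only: of_int_eq_iff)
      also have "\<dots> \<longleftrightarrow> 2 * real_of_int j = real n * of_int k" by simp
      also have "\<dots> \<longleftrightarrow> real n * (2 * (v \<bullet> \<alpha>)) = real n * of_int k"
        unfolding j[symmetric] by (simp only: mult.left_commute[of 2])
      also have "\<dots> \<longleftrightarrow> 2 * (v \<bullet> \<alpha>) = of_int k"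
        using \<open>n \<noteq> 0\<close> by (simp only: mult_cancel_left of_nat_eq_0_iff simp_thms)
      also have "\<dots> \<longleftrightarrow> of_int k = 2 * (v \<bullet> \<alpha>)" by (rule eq_commute)
      also have "2 * (v \<bullet> \<alpha>) = (v \<bullet> coroot \<alpha>) * (\<alpha> \<bullet> \<alpha>)"
        using pos by (simp add: coroot_def)
      finally show ?thesis .
    qed
    moreover have "(\<exists>k m :: int. real_of_int k = (v \<bullet> coroot \<alpha>) * (\<alpha> \<bullet> \<alpha>) \<and>
        real_of_int k = real_of_int m * (\<alpha> \<bullet> \<alpha>)) \<longleftrightarrow> v \<bullet> coroot \<alpha> \<in> \<int>"
    proof
      assume "v \<bullet> coroot \<alpha> \<in> \<int>"
      then obtain m where m: "v \<bullet> coroot \<alpha> = of_int m" by (elim Ints_cases)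
      moreover obtain i where "\<alpha> \<bullet> \<alpha> = of_int i" using norm[OF \<alpha>] by (elim Ints_cases)
      ultimately show "\<exists>k m :: int. real_of_int k = (v \<bullet> coroot \<alpha>) * (\<alpha> \<bullet> \<alpha>) \<and>
          real_of_int k = real_of_int m * (\<alpha> \<bullet> \<alpha>)"
        by (intro exI[of _ "m * i"] exI[of _ m]) simp
    next
      assume "\<exists>k m :: int. real_of_int k = (v \<bullet> coroot \<alpha>) * (\<alpha> \<bullet> \<alpha>) \<and>
          real_of_int k = real_of_int m * (\<alpha> \<bullet> \<alpha>)"
      then obtain m :: int where "(v \<bullet> coroot \<alpha>) * (\<alpha> \<bullet> \<alpha>) = real_of_int m * (\<alpha> \<bullet> \<alpha>)" by metis
      then have "v \<bullet> coroot \<alpha> = of_int m" using pos by simp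
      then show "v \<bullet> coroot \<alpha> \<in> \<int>" by simp
    qed
    ultimately show ?thesis by simp
  qed
  ultimately show ?thesis
    by (intro bexI[of _ "linear_extension \<xi>"])
      (auto simp: quantum_integral_roots_linear_extension integral_roots_def)
qed

section \<open>Maximal subsystems\<close>

context irreducible_based_root_sys
begin

lemma not_lattice_full_simple:
  assumes "\<not> \<Phi> \<subseteq> sums_of \<Psi>" and neg: "\<And>\<alpha>. \<alpha> \<in> \<Psi> \<Longrightarrow> - \<alpha> \<in> \<Psi>"
  shows "\<not> \<Delta> \<subseteq> sums_of \<Psi>"
proof
  assume \<Delta>: "\<Delta> \<subseteq> sums_of \<Psi>"
  have "\<alpha> \<in> sums_of \<Psi>" if "\<alpha> \<in> \<Phi>" for \<alpha>
  proof -
    have "cf \<alpha> a *\<^sub>R a \<in> sums_of \<Psi>" if "a \<in> \<Delta>" for a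
    proof -
      obtain k where "cf \<alpha> a = of_int k" using cf_int[OF \<open>\<alpha> \<in> \<Phi>\<close>, of a] by (elim Ints_cases)
      then show ?thesis using sums_of_scaleR_int[OF _ neg, of a k] \<Delta> that by auto
    qed
    then have "(\<Sum>a\<in>\<Delta>. cf \<alpha> a *\<^sub>R a) \<in> sums_of \<Psi>" by (rule sums_of_sum)
    then show ?thesis using expand[of \<alpha>] by simp
  qed
  with assms(1) show False by blast
qed

lemma not_colattice_full_simple:
  assumes "\<not> coroot ` \<Phi> \<subseteq> sums_of S" and neg: "\<And>x. x \<in> S \<Longrightarrow> - x \<in> S"
  shows "\<not> coroot ` \<Delta> \<subseteq> sums_of S"
proof
  assume \<Delta>: "coroot ` \<Delta> \<subseteq> sums_of S"
  let ?r = "representation (coroot ` \<Delta>)"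
  have "coroot \<alpha> \<in> sums_of S" if "\<alpha> \<in> \<Phi>" for \<alpha>
  proof -
    have "?r (coroot \<alpha>) b *\<^sub>R b \<in> sums_of S" if "b \<in> coroot ` \<Delta>" for b
    proof -
      obtain k where "?r (coroot \<alpha>) b = of_int k"
        using coroot_representation_int[OF \<open>\<alpha> \<in> \<Phi>\<close>, of b] by (elim Ints_cases)
      then show ?thesis using sums_of_scaleR_int[OF _ neg, of b k] \<Delta> that by auto
    qed
    then have "(\<Sum>b\<in>coroot ` \<Delta>. ?r (coroot \<alpha>) b *\<^sub>R b) \<in> sums_of S" by (rule sums_of_sum)
    then show ?thesis
      using representation_expand[OF independent_coroot_base finite_coroot_base span_coroot_base, of "coroot \<alpha>"]
      by simp
  qed
  with assms(1) show False by blast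
qed

lemma inner_coroots_int:
  assumes "\<beta> \<in> \<Phi>" "\<And>b. b \<in> coroot ` \<Delta> \<Longrightarrow> c * (v \<bullet> b) \<in> \<int>"
  shows "c * (v \<bullet> coroot \<beta>) \<in> \<int>"
  using inner_Ints_if_inner_basis_Ints[OF independent_coroot_base finite_coroot_base span_coroot_base,
      of "coroot \<beta>" "c *\<^sub>R v"] coroot_representation_int[OF assms(1)] assms(2)
  by simp

text \<open>The prime found with \<open>v\<close> is discarded, since a torsion character of any
  order has values in the constants.\<close>

lemma maximal_eq_integral:
  assumes max: "maximal_root_subsystem \<Phi> \<Psi>" and "\<not> \<Phi> \<subseteq> sums_of \<Psi>"
  shows "\<exists>v. \<Psi> = {\<alpha> \<in> \<Phi>. v \<bullet> \<alpha> \<in> \<int>}"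
proof -
  have sub: "root_subsystem \<Phi> \<Psi>" and \<Psi>: "\<Psi> \<subseteq> \<Phi>" using max by (auto simp: maximal_root_subsystem_def)
  have neg: "- \<alpha> \<in> \<Psi>" if "\<alpha> \<in> \<Psi>" for \<alpha> using neg_subsystem[OF sub that] .
  have ints: "cf x b \<in> \<int>" if "x \<in> \<Psi>" for x b using cf_int \<Psi> that by blast
  obtain p :: int and v where v: "\<exists>b\<in>\<Delta>. v \<bullet> b \<notin> \<int>" "\<And>x. x \<in> \<Psi> \<Longrightarrow> v \<bullet> x \<in> \<int>"
    using proper_sublattice_character[OF independent_base finite_base span_base_eq ints neg
        not_lattice_full_simple[OF assms(2) neg]] by metis
  have "\<Psi> = {\<alpha> \<in> \<Phi>. v \<bullet> \<alpha> \<in> \<int>}"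
    using v \<Psi> base_subset by (intro maximal_root_subsystem_eq[OF max root_subsystem_integral]) auto
  then show ?thesis ..
qed

lemma maximal_eq_integral_roots_if_coweight:
  assumes max: "maximal_root_subsystem \<Phi> \<Psi>"
    and v: "\<exists>b\<in>coroot ` \<Delta>. v \<bullet> b \<notin> \<int>" "\<And>x. x \<in> coroot ` \<Psi> \<Longrightarrow> v \<bullet> x \<in> \<int>"
  shows "\<Psi> = integral_roots \<Phi> v"
proof (rule maximal_root_subsystem_eq[OF max root_subsystem_integral_roots])
  have "\<Psi> \<subseteq> \<Phi>" using max by (auto simp: maximal_root_subsystem_def)
  then show "\<Psi> \<subseteq> integral_roots \<Phi> v" using v(2) by (auto simp: integral_roots_def)
  show "integral_roots \<Phi> v \<noteq> \<Phi>" using v(1) base_subset by (auto simp: integral_roots_def)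
qed

text \<open>In full rank the prime is dictated by the sublattice and has to be recognized as a
  coefficient of the highest root. In lower rank every prime works, so a factor of \<gamma> is
  chosen; divisibility is not claimed in lower rank when \<gamma> = 1.\<close>

lemma maximal_eq_integral_roots:
  assumes max: "maximal_root_subsystem \<Phi> \<Psi>" and colattice: "\<not> coroot ` \<Phi> \<subseteq> sums_of (coroot ` \<Psi>)"
  shows "\<exists>v (p::nat). Factorial_Ring.prime p \<and> \<Psi> = integral_roots \<Phi> v \<and>
    (\<forall>\<alpha>\<in>\<Phi>. real p * (v \<bullet> coroot \<alpha>) \<in> \<int>) \<and>
    ((span \<Psi> = UNIV \<or> root_gamma \<Phi> \<Delta> \<noteq> 1) \<longrightarrow> p dvd root_gamma \<Phi> \<Delta>)"
proof -
  define P where "P = {h :: nat. Factorial_Ring.prime h \<and> (\<exists>\<alpha>\<in>\<Delta>. cf \<theta> \<alpha> = real h)}"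
  have gamma: "root_gamma \<Phi> \<Delta> = Lcm P" by (simp add: root_gamma_def P_def)
  have sub: "root_subsystem \<Phi> \<Psi>" and \<Psi>: "\<Psi> \<subset> \<Phi>" using max by (auto simp: maximal_root_subsystem_def)
  have neg: "- x \<in> coroot ` \<Psi>" if "x \<in> coroot ` \<Psi>" for x
    using that neg_subsystem[OF sub] by (auto simp flip: coroot_uminus)
  have ints: "representation (coroot ` \<Delta>) x b \<in> \<int>" if "x \<in> coroot ` \<Psi>" for x b
    using that coroot_representation_int \<Psi> by auto
  show ?thesis
  proof (cases "span \<Psi> = UNIV")
    case True
    obtain p :: int and v where p: "Factorial_Ring.prime p" "\<And>b. b \<in> coroot ` \<Delta> \<Longrightarrow> of_int p * (v \<bullet> b) \<in> \<int>"
      and v: "\<exists>b\<in>coroot ` \<Delta>. v \<bullet> b \<notin> \<int>" "\<And>x. x \<in> coroot ` \<Psi> \<Longrightarrow> v \<bullet> x \<in> \<int>"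
      using proper_sublattice_character[OF independent_coroot_base finite_coroot_base span_coroot_base
          ints neg not_colattice_full_simple[OF colattice neg]] by metis
    have eq: "\<Psi> = integral_roots \<Phi> v" by (rule maximal_eq_integral_roots_if_coweight[OF max v])
    have pv: "of_int p * (v \<bullet> coroot \<alpha>) \<in> \<int>" if "\<alpha> \<in> \<Phi>" for \<alpha>
      using inner_coroots_int[OF that p(2)] .
    have "\<exists>a\<in>\<Delta>. cf \<theta> a = of_int p"
      by (rule full_rank_coefficient_dual[OF p(1) pv]) (use eq True \<Psi> in auto)
    moreover have p_nat: "int (nat p) = p" "Factorial_Ring.prime (nat p)"
      using p(1) prime_gt_0_int[OF p(1)] by auto
    moreover have "real (nat p) = of_int p" using p_nat(1) by (metis of_int_of_nat_eq)
    ultimately have "nat p \<in> P" by (auto simp: P_def)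
    then have "nat p dvd root_gamma \<Phi> \<Delta>" unfolding gamma by (rule dvd_Lcm)
    then show ?thesis
      using p_nat(2) eq pv \<open>real (nat p) = of_int p\<close> by (intro exI[of _ v] exI[of _ "nat p"]) simp
  next
    case False
    obtain p :: nat where p: "Factorial_Ring.prime p" "root_gamma \<Phi> \<Delta> \<noteq> 1 \<Longrightarrow> p dvd root_gamma \<Phi> \<Delta>"
    proof (cases "P = {}")
      case True
      \<comment> \<open>Here \<gamma> is an empty least common multiple, hence 1, and 2 is an
        arbitrary choice.\<close>
      then show ?thesis using that[of 2] by (simp add: gamma)
    next
      case False
      then obtain p where "p \<in> P" by blast
      then show ?thesis using that[of p] dvd_Lcm[of p P] by (simp add: gamma P_def)
    qed
    \<comment> \<open>A multiplier coprime to a prime is nonzero, so it would put all simple coroots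
      into the span of \<Psi>, against the smaller rank.\<close>
    have "\<not> (\<forall>b\<in>coroot ` \<Delta>. of_int N *\<^sub>R b \<in> sums_of (coroot ` \<Psi>))" if "coprime N (int p)" for N
    proof
      assume *: "\<forall>b\<in>coroot ` \<Delta>. of_int N *\<^sub>R b \<in> sums_of (coroot ` \<Psi>)"
      have "N \<noteq> 0" using that p(1) not_prime_1 by auto
      have "coroot ` \<Psi> \<subseteq> span \<Psi>" by (auto simp: coroot_def intro: span_scale span_base)
      then have "span (coroot ` \<Psi>) \<subseteq> span \<Psi>" by (intro span_minimal) auto
      then have "of_int N *\<^sub>R b \<in> span \<Psi>" if "b \<in> coroot ` \<Delta>" for b
        using * that sums_of_subset_span[of "coroot ` \<Psi>"] by blast
      then have "b \<in> span \<Psi>" if "b \<in> coroot ` \<Delta>" for b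
        using span_scale[of "of_int N *\<^sub>R b" \<Psi> "1 / of_int N"] that \<open>N \<noteq> 0\<close> by simp
      then have "span (coroot ` \<Delta>) \<subseteq> span \<Psi>" by (intro span_minimal) auto
      with False span_coroot_base show False by auto
    qed
    then obtain v where v: "\<forall>b\<in>coroot ` \<Delta>. of_int (int p) * (v \<bullet> b) \<in> \<int>"
      "\<exists>b\<in>coroot ` \<Delta>. v \<bullet> b \<notin> \<int>" "\<forall>x\<in>coroot ` \<Psi>. v \<bullet> x \<in> \<int>"
      using lattice_mod_prime[OF independent_coroot_base finite_coroot_base span_coroot_base _ ints neg,
          of "int p"] p(1) by auto
    have "\<Psi> = integral_roots \<Phi> v"
      using maximal_eq_integral_roots_if_coweight[OF max v(2)] v(3) by blast
    moreover have "\<forall>\<alpha>\<in>\<Phi>. real p * (v \<bullet> coroot \<alpha>) \<in> \<int>"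
    proof
      fix \<alpha> assume "\<alpha> \<in> \<Phi>"
      then show "real p * (v \<bullet> coroot \<alpha>) \<in> \<int>"
        by (rule inner_coroots_int) (use v(1) in auto)
    qed
    ultimately show ?thesis using p False by blast
  qed
qed

text \<open>On simple roots half the squared length is the integer \<open>d\<close>. The form is
  integral on the root lattice, so cross terms 2(y \<bullet> a) are even and evenness extends to all
  sums of simple roots and their negatives.\<close>

lemma norm_root_even:
  assumes "normalized_form \<Delta>" "\<alpha> \<in> \<Phi>"
  shows "(\<alpha> \<bullet> \<alpha>) / 2 \<in> \<int>"
proof -
  obtain d :: "'a \<Rightarrow> nat" where
    d: "\<And>a b. a \<in> \<Delta> \<Longrightarrow> b \<in> \<Delta> \<Longrightarrow> a \<bullet> b = real (d a) * (coroot a \<bullet> b)"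
    using assms(1) unfolding normalized_form_def by blast
  have ab: "a \<bullet> b \<in> \<int>" if "a \<in> \<Delta>" "b \<in> \<Delta>" for a b
  proof -
    have "coroot a \<bullet> b \<in> \<int>"
      using cartan_int[of b a] base_subset that by (auto simp: inner_commute)
    then show ?thesis unfolding d[OF that] by (intro Ints_mult Ints_of_nat)
  qed
  have aa: "a \<bullet> a / 2 \<in> \<int>" if "a \<in> \<Delta>" for a
  proof -
    have "coroot a \<bullet> a = 2" using root_nonzero[of a] base_subset that by (auto simp: coroot_def)
    then show ?thesis using d[OF that that] by simp
  qed
  have even: "\<exists>m::int. x \<bullet> x = 2 * of_int m \<and> (\<forall>b\<in>\<Delta>. x \<bullet> b \<in> \<int>)" if "x \<in> sums_of (\<Delta> \<union> uminus ` \<Delta>)" for x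
    using that
  proof (induction rule: sums_of_induct)
    case zero
    show ?case by (auto intro: exI[of _ 0])
  next
    case (add a y)
    obtain m where m: "y \<bullet> y = 2 * of_int m" "\<forall>b\<in>\<Delta>. y \<bullet> b \<in> \<int>" using add(3) by blast
    obtain s where a: "a = s \<or> a = - s" "s \<in> \<Delta>" using add(1) by blast
    obtain i where i: "s \<bullet> s / 2 = of_int i" using aa[OF a(2)] by (elim Ints_cases)
    have "y \<bullet> a \<in> \<int>" using m(2) a by auto
    then obtain j where j: "y \<bullet> a = of_int j" by (elim Ints_cases)
    have "(a + y) \<bullet> (a + y) = a \<bullet> a + 2 * (y \<bullet> a) + y \<bullet> y"
      by (simp add: inner_add_left inner_add_right inner_commute)
    also have "\<dots> = 2 * of_int (i + j + m)" using a(1) i j m(1) by auto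
    finally have "\<exists>m::int. (a + y) \<bullet> (a + y) = 2 * of_int m" by blast
    moreover have "(a + y) \<bullet> b \<in> \<int>" if "b \<in> \<Delta>" for b
      using a m(2) ab[OF a(2) that] that by (auto simp: inner_add_left)
    ultimately show ?case by blast
  qed
  have "\<alpha> \<in> sums_of (\<Delta> \<union> uminus ` \<Delta>)"
  proof (rule ccontr)
    assume "\<alpha> \<notin> sums_of (\<Delta> \<union> uminus ` \<Delta>)"
    then have "\<not> \<Phi> \<subseteq> sums_of (\<Delta> \<union> uminus ` \<Delta>)" using assms(2) by blast
    then have "\<not> \<Delta> \<subseteq> sums_of (\<Delta> \<union> uminus ` \<Delta>)" by (rule not_lattice_full_simple) auto
    moreover have "\<Delta> \<subseteq> sums_of (\<Delta> \<union> uminus ` \<Delta>)" by (intro subsetI sums_of_base) simp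
    ultimately show False by simp
  qed
  then obtain m :: int where "\<alpha> \<bullet> \<alpha> = 2 * of_int m" using even by blast
  then show ?thesis by simp
qed

end

theorem proposition5p10:
  fixes \<Phi> \<Delta> \<Psi> :: "'a::euclidean_space set"
    and t :: qclosure
  assumes "irreducible_root_system \<Phi>"
    and "root_base \<Phi> \<Delta>"
    and "normalized_form \<Delta>"
    and "t ^ root_gamma \<Phi> \<Delta> = qvar"
    and "maximal_root_subsystem \<Phi> \<Psi>"
  shows "(\<exists>\<Lambda>\<in>torus_characters \<Phi> (complex_adjoin t). \<Psi> = quantum_integral_roots \<Phi> \<Lambda>) \<and>
    (closed_in_roots (coroot ` \<Phi>) (coroot ` \<Psi>) \<longrightarrow>
      (\<exists>\<mu>. \<Psi> = integral_roots \<Phi> \<mu> \<and>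
        (root_gamma \<Phi> \<Delta> \<noteq> 1 \<longrightarrow> \<mu> \<in> (\<lambda>\<nu>. (1 / real (root_gamma \<Phi> \<Delta>)) *\<^sub>R \<nu>) ` weight_lattice \<Phi>)))"
proof
  interpret irreducible_based_root_sys \<Phi> \<Delta>
    by unfold_locales (use assms in \<open>auto simp: irreducible_root_system_def\<close>)
  let ?\<gamma> = "root_gamma \<Phi> \<Delta>"
  have sub: "root_subsystem \<Phi> \<Psi>" and \<Psi>: "\<Psi> \<subset> \<Phi>"
    using assms(5) by (auto simp: maximal_root_subsystem_def)
  have gamma_int: "real ?\<gamma> * (v \<bullet> coroot \<alpha>) \<in> \<int>"
    if "real p * (v \<bullet> coroot \<alpha>) \<in> \<int>" "p dvd ?\<gamma>" for v \<alpha> p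
  proof -
    obtain k where "?\<gamma> = p * k" using \<open>p dvd ?\<gamma>\<close> by (elim dvdE)
    then have "real ?\<gamma> * (v \<bullet> coroot \<alpha>) = real k * (real p * (v \<bullet> coroot \<alpha>))" by simp
    also have "\<dots> \<in> \<int>" by (rule Ints_mult[OF _ that(1)]) simp
    finally show ?thesis .
  qed
  show "\<exists>\<Lambda>\<in>torus_characters \<Phi> (complex_adjoin t). \<Psi> = quantum_integral_roots \<Phi> \<Lambda>"
  proof (cases "\<Phi> \<subseteq> sums_of \<Psi>")
    case False
    then obtain v where "\<Psi> = {\<alpha> \<in> \<Phi>. v \<bullet> \<alpha> \<in> \<int>}" using maximal_eq_integral[OF assms(5)] by blast
    moreover obtain \<Lambda> where \<Lambda>: "\<Lambda> \<in> torus_characters \<Phi> (complex_adjoin t)"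
      "quantum_integral_roots \<Phi> \<Lambda> = {\<alpha> \<in> \<Phi>. v \<bullet> \<alpha> \<in> \<int>}"
      by (rule bexE[OF quantum_integral_roots_torsion[OF complex_adjoin_const is_subfield_complex_adjoin]])
    ultimately show ?thesis by (intro bexI[OF _ \<Lambda>(1)]) (simp only: \<Lambda>(2))
  next
    case True
    then have "\<not> coroot ` \<Phi> \<subseteq> sums_of (coroot ` \<Psi>)"
      using subsystem_eq_if_lattices_full[OF sub] \<Psi> by blast
    \<comment> \<open>Generating the root lattice forces full rank, so here \<open>p\<close> divides
      \<gamma> unconditionally.\<close>
    moreover have "span \<Phi> \<subseteq> span \<Psi>"
      using True sums_of_subset_span[of \<Psi>] by (intro span_minimal) auto
    then have "span \<Psi> = UNIV" using span_roots by auto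
    ultimately obtain v and p :: nat where v: "\<Psi> = integral_roots \<Phi> v" "p dvd ?\<gamma>"
      "\<forall>\<alpha>\<in>\<Phi>. real p * (v \<bullet> coroot \<alpha>) \<in> \<int>"
      using maximal_eq_integral_roots[OF assms(5)] by blast
    have int: "real ?\<gamma> * (v \<bullet> \<alpha>) \<in> \<int>" if \<alpha>: "\<alpha> \<in> \<Phi>" for \<alpha>
    proof -
      have "real ?\<gamma> * (v \<bullet> \<alpha>) = (real ?\<gamma> * (v \<bullet> coroot \<alpha>)) * ((\<alpha> \<bullet> \<alpha>) / 2)"
        using root_nonzero[OF \<alpha>] by (simp add: inner_coroot)
      also have "\<dots> \<in> \<int>"
        using gamma_int[OF bspec[OF v(3) \<alpha>] v(2)] norm_root_even[OF assms(3) \<alpha>] by (rule Ints_mult)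
      finally show ?thesis .
    qed
    have nonzero: "0 \<notin> \<Phi>" using root_nonzero by blast
    have norm: "\<alpha> \<bullet> \<alpha> \<in> \<int>" if "\<alpha> \<in> \<Phi>" for \<alpha>
      using Ints_mult[OF _ norm_root_even[OF assms(3) that], of 2] by simp
    obtain \<Lambda> where \<Lambda>: "\<Lambda> \<in> torus_characters \<Phi> (complex_adjoin t)"
      "quantum_integral_roots \<Phi> \<Lambda> = integral_roots \<Phi> v"
      by (rule bexE[OF quantum_integral_roots_weight[OF assms(4) complex_adjoin_generator
              is_subfield_complex_adjoin int nonzero norm]])
    show ?thesis by (rule bexI[OF _ \<Lambda>(1)]) (simp only: \<Lambda>(2) v(1)[symmetric])
  qed
  show "closed_in_roots (coroot ` \<Phi>) (coroot ` \<Psi>) \<longrightarrow>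
      (\<exists>\<mu>. \<Psi> = integral_roots \<Phi> \<mu> \<and>
        (?\<gamma> \<noteq> 1 \<longrightarrow> \<mu> \<in> (\<lambda>\<nu>. (1 / real ?\<gamma>) *\<^sub>R \<nu>) ` weight_lattice \<Phi>))"
  proof
    assume closed: "closed_in_roots (coroot ` \<Phi>) (coroot ` \<Psi>)"
    interpret dual: root_sys "coroot ` \<Phi>" by unfold_locales (rule root_system_dual)
    have "\<not> coroot ` \<Phi> \<subseteq> sums_of (coroot ` \<Psi>)"
    proof
      assume "coroot ` \<Phi> \<subseteq> sums_of (coroot ` \<Psi>)"
      then have "coroot ` \<Phi> \<subseteq> coroot ` \<Psi>"
        using dual.closed_contains_sums[OF closed] \<Psi> by blast
      then show False using \<Psi> by (simp add: inj_image_subset_iff[OF inj_coroot])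
    qed
    then obtain v and p :: nat where v: "\<Psi> = integral_roots \<Phi> v"
      "\<forall>\<alpha>\<in>\<Phi>. real p * (v \<bullet> coroot \<alpha>) \<in> \<int>" "?\<gamma> \<noteq> 1 \<Longrightarrow> p dvd ?\<gamma>"
      using maximal_eq_integral_roots[OF assms(5)] by blast
    have "v \<in> (\<lambda>\<nu>. (1 / real ?\<gamma>) *\<^sub>R \<nu>) ` weight_lattice \<Phi>" if "?\<gamma> \<noteq> 1"
    proof -
      \<comment> \<open>Division by \<gamma> requires this; \<gamma> = 0 would make q equal to
        \<open>t ^ 0\<close>, that is 1.\<close>
      have "?\<gamma> \<noteq> 0"
      proof
        assume "?\<gamma> = 0"
        then have "qconst 1 = qvar powi 1 * 1" using assms(4) by (simp add: qconst_1)
        then show False using qconst_eq_qvar_power_int[of 1 1] by simp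
      qed
      moreover have "real ?\<gamma> *\<^sub>R v \<in> weight_lattice \<Phi>"
        using gamma_int[OF _ v(3)[OF that]] v(2) by (auto simp: weight_lattice_def)
      ultimately show ?thesis by (intro image_eqI[of _ _ "real ?\<gamma> *\<^sub>R v"]) simp_all
    qed
    with v(1) show "\<exists>\<mu>. \<Psi> = integral_roots \<Phi> \<mu> \<and>
        (?\<gamma> \<noteq> 1 \<longrightarrow> \<mu> \<in> (\<lambda>\<nu>. (1 / real ?\<gamma>) *\<^sub>R \<nu>) ` weight_lattice \<Phi>)" by blast
  qed
qed

end
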